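(* Let $k\in\mathbb{N}=\{0,1,2,\dots\}$ and $\ell\in\mathbb{R}_{\geq 0}$, and let $(J_t:t\in V(T))$ be a tree-decomposition of a graph $G$ of width at most $k$, indexed by a tree $T$. Then there exist a graph $H$, a $T$-decomposition $(B_t:t\in V(T))$ of $H$ (indexed by the same tree $T$) of width at most $k$, and an $\ell$-compressing $H$-indexed partition $(P_x:x\in V(H))$ of $G$ each of whose parts has weak diameter in $G$ at most $2(k+1)\ell$.
   Context: For a tree $T$, a $T$-decomposition of a graph $G$ is a family $(J_t:t\in V(T))$ of subsets of $V(G)$ such that for each $v\in V(G)$ the set $\{t: v\in J_t\}$ induces a nonempty subtree of $T$, and for each edge $uv\in E(G)$ some $J_t$ contains both $u$ and $v$; a tree-decomposition is a $T$-decomposition for some tree $T$, and its width is $\max_t |J_t|-1$. For a graph $H$, an $H$-indexed partition of $G$ is a family $(P_x:x\in V(H))$ of pairwise disjoint (possibly empty) subsets of $V(G)$ with union $V(G)$; it is $\ell$-compressing in $G$ if for all distinct $x,y\in V(H)$ with $\operatorname{dist}_G(P_x,P_y)\leq\ell$ (minimum distance in $G$ between a vertex of $P_x$ and a vertex of $P_y$), $x$ and $y$ are adjacent in $H$. The weak diameter in $G$ of $S\subseteq V(G)$ is the maximum of $\operatorname{dist}_G(u,v)$ over $u,v\in S$. *)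

theory Defs
  imports "HOL-Library.Extended_Real"
begin

(* Graphs are simple and undirected, finite or infinite; an edge is a two-element set of vertices. *)

record 'a ugraph =
  verts :: "'a set"
  edges :: "'a set set"

definition simple_graph :: "'a ugraph \<Rightarrow> bool" where
  "simple_graph G \<longleftrightarrow>
     (\<forall>e \<in> edges G. \<exists>u \<in> verts G. \<exists>v \<in> verts G. u \<noteq> v \<and> e = {u, v})"

definition adjacent :: "'a ugraph \<Rightarrow> 'a \<Rightarrow> 'a \<Rightarrow> bool" where
  "adjacent G u v \<longleftrightarrow> {u, v} \<in> edges G"

definition induced :: "'a ugraph \<Rightarrow> 'a set \<Rightarrow> 'a ugraph" where
  "induced G S = \<lparr>verts = verts G \<inter> S, edges = {e \<in> edges G. e \<subseteq> S}\<rparr>"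

definition walk :: "'a ugraph \<Rightarrow> 'a list \<Rightarrow> bool" where
  "walk G xs \<longleftrightarrow> xs \<noteq> [] \<and> set xs \<subseteq> verts G \<and> successively (adjacent G) xs"

definition walk_between :: "'a ugraph \<Rightarrow> 'a \<Rightarrow> 'a list \<Rightarrow> 'a \<Rightarrow> bool" where
  "walk_between G u xs v \<longleftrightarrow> walk G xs \<and> hd xs = u \<and> last xs = v"

definition connected_graph :: "'a ugraph \<Rightarrow> bool" where
  "connected_graph G \<longleftrightarrow>
     verts G \<noteq> {} \<and> (\<forall>u \<in> verts G. \<forall>v \<in> verts G. \<exists>xs. walk_between G u xs v)"

definition graph_cycle :: "'a ugraph \<Rightarrow> 'a list \<Rightarrow> bool" where
  "graph_cycle G xs \<longleftrightarrow>
     walk G xs \<and> distinct xs \<and> length xs \<ge> 3 \<and> adjacent G (last xs) (hd xs)"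

definition tree :: "'a ugraph \<Rightarrow> bool" where
  "tree T \<longleftrightarrow> simple_graph T \<and> connected_graph T \<and> (\<nexists>xs. graph_cycle T xs)"

(* The distance is infinite between different components, and so is the distance to the empty set. *)

definition gdist :: "'a ugraph \<Rightarrow> 'a \<Rightarrow> 'a \<Rightarrow> enat" where
  "gdist G u v = (INF xs \<in> {xs. walk_between G u xs v}. enat (length xs - 1))"

definition set_gdist :: "'a ugraph \<Rightarrow> 'a set \<Rightarrow> 'a set \<Rightarrow> enat" where
  "set_gdist G A B = (INF u \<in> A. INF v \<in> B. gdist G u v)"

definition weak_diameter :: "'a ugraph \<Rightarrow> 'a set \<Rightarrow> enat" where
  "weak_diameter G S = (SUP u \<in> S. SUP v \<in> S. gdist G u v)"

(* As tree requires a vertex, the second condition says that the subtree is nonempty. *)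

definition tree_indexed_decomposition ::
    "'t ugraph \<Rightarrow> 'a ugraph \<Rightarrow> ('t \<Rightarrow> 'a set) \<Rightarrow> bool" where
  "tree_indexed_decomposition T G J \<longleftrightarrow>
     (\<forall>t \<in> verts T. J t \<subseteq> verts G) \<and>
     (\<forall>v \<in> verts G. tree (induced T {t \<in> verts T. v \<in> J t})) \<and>
     (\<forall>u v. adjacent G u v \<longrightarrow> (\<exists>t \<in> verts T. u \<in> J t \<and> v \<in> J t))"

definition set_size :: "'a set \<Rightarrow> enat" where
  "set_size S = (if finite S then enat (card S) else \<infinity>)"

(* The subtraction is done in ereal because truncated subtraction in enat would give
   width 0 instead of -1 when all bags are empty. *)

definition width :: "'t ugraph \<Rightarrow> ('t \<Rightarrow> 'a set) \<Rightarrow> ereal" where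
  "width T J = ereal_of_enat (SUP t \<in> verts T. set_size (J t)) - 1"

definition graph_indexed_partition ::
    "'h ugraph \<Rightarrow> 'a ugraph \<Rightarrow> ('h \<Rightarrow> 'a set) \<Rightarrow> bool" where
  "graph_indexed_partition H G P \<longleftrightarrow>
     (\<forall>x \<in> verts H. \<forall>y \<in> verts H. x \<noteq> y \<longrightarrow> P x \<inter> P y = {}) \<and>
     (\<Union>x \<in> verts H. P x) = verts G"

definition compressing ::
    "real \<Rightarrow> 'h ugraph \<Rightarrow> 'a ugraph \<Rightarrow> ('h \<Rightarrow> 'a set) \<Rightarrow> bool" where
  "compressing l H G P \<longleftrightarrow>
     (\<forall>x \<in> verts H. \<forall>y \<in> verts H.
        x \<noteq> y \<and> ereal_of_enat (set_gdist G (P x) (P y)) \<le> ereal l \<longrightarrow> adjacent H x y)"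

lemma width_le_iff:
  "width T J \<le> ereal (real k) \<longleftrightarrow> (\<forall>t \<in> verts T. finite (J t) \<and> card (J t) \<le> k + 1)"
proof -
  have "width T J \<le> ereal (real k) \<longleftrightarrow>
        ereal_of_enat (SUP t \<in> verts T. set_size (J t)) \<le> ereal_of_enat (enat (k + 1))"
    unfolding width_def
    by (cases "SUP t \<in> verts T. set_size (J t)") (auto simp: one_ereal_def)
  also have "\<dots> \<longleftrightarrow> (\<forall>t \<in> verts T. set_size (J t) \<le> enat (k + 1))"
    by (simp only: ereal_of_enat_le_iff SUP_le_iff)
  also have "\<dots> \<longleftrightarrow> (\<forall>t \<in> verts T. finite (J t) \<and> card (J t) \<le> k + 1)"
    by (auto simp: set_size_def)
  finally show ?thesis .
qed

end

theory Submission imports Defs begin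

text \<open>
  Let \<open>n\<close> be the integer part of \<open>l\<close>. Root \<open>T\<close> and walk down from the root, keeping at every
  node \<open>t\<close> a list \<open>x\<^sub>0, x\<^sub>1, \<dots>\<close> of at most \<open>|J\<^sub>t|\<close> active labels (vertices of \<open>G\<close>) together with a
  partial map from vertices to labels. The \<open>i\<close>-th active label governs the ball of radius
  \<open>(k + 1 - i)n\<close> about \<open>x\<^sub>i\<close>. When the walk enters the part of \<open>G\<close> behind an adhesion set \<open>A\<close>, only
  those labels matter that still have a vertex with an unassigned vertex within distance \<open>n\<close>;
  every geodesic from the label to such a vertex meets \<open>A\<close>. Let every \<open>j \<in> A\<close> be owned by the
  last label in the list that reaches such a vertex through \<open>j\<close>. If there are more labels than
  elements of \<open>A\<close>, some label owns nothing. It is deleted; the later labels move up one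
  place, so their radii grow by \<open>n\<close>, and the grown balls swallow all the unassigned vertices near
  the part of the deleted label. Afterwards the vertices whose highest bag is \<open>J\<^sub>t\<close> are
  appended as new labels. All radii are at most \<open>(k + 1)n\<close>, vertices at distance at most \<open>n\<close>
  receive labels that are active at a common node, and the nodes at which a label is active form
  a subtree, so the sets of active labels are the bags of the required decomposition.
\<close>

subsection \<open>Walks and distances\<close>

lemma adjacent_sym: "adjacent G u v \<longleftrightarrow> adjacent G v u"
  by (simp add: adjacent_def insert_commute)

lemma adjacent_verts:
  assumes "simple_graph G" and "adjacent G u v"
  shows "u \<in> verts G" "v \<in> verts G" "u \<noteq> v"
proof -
  from assms obtain x y where "x \<in> verts G" "y \<in> verts G" "x \<noteq> y" "{u, v} = {x, y}"
    unfolding simple_graph_def adjacent_def by blast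
  then show "u \<in> verts G" "v \<in> verts G" "u \<noteq> v" by (auto simp: doubleton_eq_iff)
qed

lemma walk_between_refl: "u \<in> verts G \<Longrightarrow> walk_between G u [u] u"
  by (simp add: walk_between_def walk_def)

lemma walk_between_rev: "walk_between G u xs v \<Longrightarrow> walk_between G v (rev xs) u"
  unfolding walk_between_def walk_def
  by (auto simp: hd_rev last_rev adjacent_sym[of G] intro: successively_mono)

lemma walk_between_Cons:
  assumes "walk_between G v xs w" and "adjacent G u v" and "u \<in> verts G"
  shows "walk_between G u (u # xs) w"
  using assms by (auto simp: walk_between_def walk_def successively_Cons)

lemma walk_between_append:
  assumes "walk_between G u xs v" and "walk_between G v ys w"
  shows "walk_between G u (xs @ tl ys) w"
proof -
  from assms(2) have ys: "ys = v # tl ys" unfolding walk_between_def walk_def by (metis list.collapse)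
  have "successively (adjacent G) (v # tl ys)" "last (v # tl ys) = w" "set (tl ys) \<subseteq> verts G"
    using assms(2) ys unfolding walk_between_def walk_def by (metis, metis, metis order_trans set_subset_Cons)
  then show ?thesis
    using assms(1) unfolding walk_between_def walk_def
    by (auto simp: successively_append_iff successively_Cons split: if_splits)
qed

lemma walk_between_split:
  assumes "walk_between G u (xs @ j # ys) v"
  shows "walk_between G u (xs @ [j]) j" "walk_between G j (j # ys) v"
  using assms unfolding walk_between_def walk_def
  by (auto simp: successively_append_iff successively_Cons hd_append split: if_splits)

lemma gdist_le: "walk_between G u xs v \<Longrightarrow> gdist G u v \<le> enat (length xs - 1)"
  unfolding gdist_def by (auto intro: INF_lower)

lemma gdist_walk:
  assumes "gdist G u v \<noteq> \<infinity>"
  obtains xs where "walk_between G u xs v" "gdist G u v = enat (length xs - 1)"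
proof -
  let ?A = "(\<lambda>xs. enat (length xs - 1)) ` {xs. walk_between G u xs v}"
  have "?A \<noteq> {}"
  proof
    assume "?A = {}"
    then have "gdist G u v = Inf {}" unfolding gdist_def by simp
    with assms show False by (simp add: top_enat_def)
  qed
  then obtain a where "a \<in> ?A" by blast
  then have "(LEAST x. x \<in> ?A) \<in> ?A" by (rule LeastI)
  then have "Inf ?A \<in> ?A" using \<open>?A \<noteq> {}\<close> by (simp only: Inf_enat_def if_False)
  then show ?thesis using that by (auto simp: gdist_def)
qed

lemma gdist_refl: "u \<in> verts G \<Longrightarrow> gdist G u u = 0"
  using gdist_le[OF walk_between_refl, of u G] by (simp flip: zero_enat_def)

lemma gdist_sym: "gdist G u v = gdist G v u"
proof -
  have "gdist G u v \<le> gdist G v u" for u v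
  proof (cases "gdist G v u = \<infinity>")
    case False
    then obtain xs where "walk_between G v xs u" "gdist G v u = enat (length xs - 1)"
      by (rule gdist_walk)
    then show ?thesis using gdist_le[OF walk_between_rev] by fastforce
  qed simp
  then show ?thesis by (simp add: antisym)
qed

lemma gdist_triangle: "gdist G u w \<le> gdist G u v + gdist G v w"
proof (cases "gdist G u v = \<infinity> \<or> gdist G v w = \<infinity>")
  case False
  then obtain xs ys where xs: "walk_between G u xs v" "gdist G u v = enat (length xs - 1)"
    and ys: "walk_between G v ys w" "gdist G v w = enat (length ys - 1)"
    by (metis gdist_walk)
  have "xs \<noteq> []" "ys \<noteq> []" using xs ys by (auto simp: walk_between_def walk_def)
  then have "length (xs @ tl ys) - 1 = (length xs - 1) + (length ys - 1)"
    by (cases xs; cases ys) auto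
  then show ?thesis
    using gdist_le[OF walk_between_append[OF xs(1) ys(1)]] xs(2) ys(2) by simp
qed auto

text \<open>A shortest walk meets \<open>A\<close>. Cut there, its two pieces bound the sum of the
  distances by \<open>gdist G u v\<close>; the triangle inequality is the reverse bound.\<close>

lemma gdist_through:
  assumes "gdist G u v \<noteq> \<infinity>"
    and "\<And>xs. walk_between G u xs v \<Longrightarrow> set xs \<inter> A \<noteq> {}"
  shows "\<exists>j \<in> A. gdist G u j + gdist G j v = gdist G u v"
proof -
  from assms(1) obtain xs where xs: "walk_between G u xs v" "gdist G u v = enat (length xs - 1)"
    by (rule gdist_walk)
  from assms(2)[OF xs(1)] obtain j ys zs where j: "j \<in> A" "xs = ys @ j # zs"
    by (metis disjoint_iff in_set_conv_decomp)
  have "gdist G u j \<le> enat (length ys)" "gdist G j v \<le> enat (length zs)"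
    using walk_between_split[of G u ys j zs v] xs(1) j(2) gdist_le by fastforce+
  then have "gdist G u j + gdist G j v \<le> enat (length ys) + enat (length zs)" by (rule add_mono)
  then have "gdist G u j + gdist G j v \<le> gdist G u v" using xs(2) j(2) by simp
  with gdist_triangle[of G u v j] j(1) show ?thesis by (auto intro: antisym)
qed

lemma walk_leaves:
  assumes "walk_between G u xs v" and "u \<in> D" and "v \<notin> D"
  shows "\<exists>x y. x \<in> set xs \<and> y \<in> set xs \<and> adjacent G x y \<and> x \<in> D \<and> y \<notin> D"
  using assms
proof (induction xs arbitrary: u)
  case Nil
  then show ?case by (simp add: walk_between_def walk_def)
next
  case (Cons x xs)
  have x: "x = u" using Cons.prems by (simp add: walk_between_def)
  have "xs \<noteq> []" using Cons.prems x by (auto simp: walk_between_def)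
  then have w: "walk_between G (hd xs) xs v" "adjacent G u (hd xs)"
    using Cons.prems x by (auto simp: walk_between_def walk_def successively_Cons)
  show ?case
  proof (cases "hd xs \<in> D")
    case True
    from Cons.IH[OF w(1) True Cons.prems(3)] show ?thesis by (meson list.set_intros(2))
  next
    case False
    then show ?thesis using w(2) Cons.prems(2) x \<open>xs \<noteq> []\<close> by (meson hd_in_set list.set_intros)
  qed
qed

subsection \<open>Rooted trees\<close>

text \<open>\<open>par r = r\<close> keeps \<open>par\<close> iterable everywhere, and
  \<open>dep\<close> is the measure for inductions towards the root. Acyclicity of a tree enters
  through \<open>edge\<close>: only edges to parents exist.\<close>

locale rooted_tree =
  fixes T :: "'t ugraph" and r :: 't and par :: "'t \<Rightarrow> 't" and dep :: "'t \<Rightarrow> nat"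
  assumes simple: "simple_graph T"
    and root: "r \<in> verts T" "par r = r" "dep r = 0"
    and par: "t \<in> verts T \<Longrightarrow> t \<noteq> r \<Longrightarrow> par t \<in> verts T"
      "t \<in> verts T \<Longrightarrow> t \<noteq> r \<Longrightarrow> adjacent T t (par t)"
      "t \<in> verts T \<Longrightarrow> t \<noteq> r \<Longrightarrow> dep t = Suc (dep (par t))"
    and edge: "adjacent T s t \<Longrightarrow> s = par t \<and> t \<noteq> r \<or> t = par s \<and> s \<noteq> r"
begin

text \<open>The descendants of \<open>s\<close>, including \<open>s\<close>.\<close>

definition sub :: "'t \<Rightarrow> 't set" where
  "sub s = {t \<in> verts T. \<exists>i. (par ^^ i) t = s}"

lemma sub_refl: "t \<in> verts T \<Longrightarrow> t \<in> sub t"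
  unfolding sub_def by (auto intro: exI[of _ 0])

lemma sub_verts: "t \<in> sub s \<Longrightarrow> t \<in> verts T"
  by (simp add: sub_def)

lemma sub_step: "par t \<in> sub s \<Longrightarrow> t \<in> verts T \<Longrightarrow> t \<in> sub s"
proof -
  assume "par t \<in> sub s" and t: "t \<in> verts T"
  then obtain i where "(par ^^ i) (par t) = s" by (auto simp: sub_def)
  then have "(par ^^ Suc i) t = s" by (simp add: funpow_swap1)
  with t show ?thesis unfolding sub_def by blast
qed

lemma sub_par: "t \<in> sub s \<Longrightarrow> t \<noteq> s \<Longrightarrow> par t \<in> sub s"
proof -
  assume t: "t \<in> sub s" "t \<noteq> s"
  then obtain i where "t \<in> verts T" "(par ^^ i) t = s" by (auto simp: sub_def)
  moreover from this t(2) obtain m where "i = Suc m" by (cases i) auto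
  ultimately show ?thesis using par(1)[of t] root unfolding sub_def
    by (cases "t = r") (auto simp: funpow_swap1)
qed

lemma par_in_verts: "t \<in> verts T \<Longrightarrow> par t \<in> verts T"
  using par(1) root by (cases "t = r") auto

lemma root_in_sub: "r \<in> sub s \<Longrightarrow> s = r"
proof -
  have "(par ^^ i) r = r" for i by (induction i) (simp_all add: root)
  then show "r \<in> sub s \<Longrightarrow> s = r" by (auto simp: sub_def)
qed

lemma sub_trans: "t \<in> sub s \<Longrightarrow> s \<in> sub q \<Longrightarrow> t \<in> sub q"
  unfolding sub_def by (auto simp: funpow_add[symmetric, THEN fun_cong, unfolded comp_def])

lemma dep_par_le: "t \<in> verts T \<Longrightarrow> dep (par t) \<le> dep t"
  using par(3)[of t] root by (cases "t = r") auto

lemma sub_dep: "t \<in> sub s \<Longrightarrow> dep s \<le> dep t"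
proof -
  assume "t \<in> sub s"
  then obtain i where i: "t \<in> verts T" "(par ^^ i) t = s" by (auto simp: sub_def)
  have "(par ^^ i) t \<in> verts T \<and> dep ((par ^^ i) t) \<le> dep t" for i
    using i(1) by (induction i) (auto intro: par_in_verts dep_par_le order_trans)
  then show ?thesis using i(2) by blast
qed

lemma sub_root: "t \<in> verts T \<Longrightarrow> t \<in> sub r"
proof (induction "dep t" arbitrary: t)
  case 0
  then show ?case using par(3)[of t] sub_refl by (cases "t = r") auto
next
  case (Suc m)
  then have "t \<noteq> r" using root by auto
  then show ?case using Suc par sub_step by fastforce
qed

lemma parent_not_in_sub: "t \<in> verts T \<Longrightarrow> t \<noteq> r \<Longrightarrow> par t \<notin> sub t"
  using par(3) sub_dep by fastforce

lemma sub_par_mono: "t \<in> verts T \<Longrightarrow> sub t \<subseteq> sub (par t)"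
  using sub_trans sub_step sub_refl par_in_verts by blast

lemma sub_not_root: "t \<in> sub s \<Longrightarrow> t \<noteq> s \<Longrightarrow> t \<noteq> r"
  using root_in_sub by blast

lemma sub_child:
  assumes "t \<in> sub s" and "t \<noteq> s"
  shows "\<exists>e \<in> verts T. e \<noteq> r \<and> par e = s \<and> t \<in> sub e"
  using assms
proof (induction "dep t" arbitrary: t rule: less_induct)
  case less
  have t: "t \<in> verts T" "t \<noteq> r" "par t \<in> sub s"
    using less.prems sub_verts sub_par sub_not_root by blast+
  show ?case
  proof (cases "par t = s")
    case True
    then show ?thesis using t sub_refl by blast
  next
    case False
    then show ?thesis using less.hyps[of "par t"] t par(3)[of t] sub_step by auto
  qed
qed

text \<open>A node \<open>b\<close> of least depth is the top. For any other \<open>t\<close> in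
  \<open>S\<close>, a walk inside \<open>S\<close> from \<open>t\<close> to \<open>b\<close> must
  leave \<open>sub t\<close>, and the only edge leaving \<open>sub t\<close> joins \<open>t\<close>
  to \<open>par t\<close>.\<close>

lemma connected_top:
  assumes S: "connected_graph (induced T S)"
  shows "\<exists>b \<in> verts T \<inter> S. \<forall>t \<in> verts T \<inter> S. t \<in> sub b \<and> (t \<noteq> b \<longrightarrow> par t \<in> S)"
proof -
  let ?S = "verts T \<inter> S"
  have "?S \<noteq> {}" using S by (simp add: connected_graph_def induced_def)
  then obtain b where b: "b \<in> ?S" "\<And>t. t \<in> ?S \<Longrightarrow> dep b \<le> dep t"
    using exists_least_iff[of "\<lambda>m. \<exists>t \<in> ?S. dep t = m"] by (metis all_not_in_conv not_le)
  have p: "par t \<in> S" if t: "t \<in> ?S" "t \<noteq> b" for t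
  proof -
    have nb: "b \<notin> sub t"
    proof
      assume b': "b \<in> sub t"
      with t(2) have "par b \<in> sub t" "b \<noteq> r" using sub_par[OF b'] root_in_sub by auto
      then show False using par(3)[of b] b t sub_dep by fastforce
    qed
    obtain xs where "walk_between (induced T S) t xs b"
      using S t b(1) by (auto simp: connected_graph_def induced_def)
    from walk_leaves[OF this sub_refl nb] t obtain x y where
      xy: "x \<in> set xs" "y \<in> set xs" "adjacent (induced T S) x y" "x \<in> sub t" "y \<notin> sub t" by blast
    have adj: "adjacent T x y" "y \<in> S" using xy(3) by (auto simp: adjacent_def induced_def)
    have "y \<noteq> x" using xy by auto
    from edge[OF adj(1)] show ?thesis
    proof
      assume "x = par y \<and> y \<noteq> r"
      then show ?thesis using sub_step xy adjacent_verts[OF simple adj(1)] by blast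
    next
      assume "y = par x \<and> x \<noteq> r"
      then show ?thesis using sub_par xy adj(2) by blast
    qed
  qed
  have "t \<in> sub b" if "t \<in> ?S" for t using that
  proof (induction "dep t" arbitrary: t rule: less_induct)
    case less
    show ?case
    proof (cases "t = b")
      case True then show ?thesis using sub_refl less by simp
    next
      case False
      have "t \<noteq> r"
      proof
        assume "t = r"
        then have "dep b = 0" using b(2)[OF less(2)] root by simp
        then show False using False \<open>t = r\<close> par(3)[of b] b(1) by auto
      qed
      then show ?thesis using less p[OF less(2) False] par[of t] sub_step[of t b] by simp
    qed
  qed
  with b p show ?thesis by blast
qed

text \<open>The converse of \<open>connected_top\<close> for acyclic \<open>T\<close>: climbing
  along parents stays in \<open>S\<close> and ends at \<open>b\<close>, so any two nodes are joined
  through \<open>b\<close>.\<close>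

lemma subtree:
  assumes "b \<in> verts T \<inter> S" and "\<And>t. t \<in> verts T \<inter> S \<Longrightarrow> t \<in> sub b"
    and "\<And>t. t \<in> verts T \<inter> S \<Longrightarrow> t \<noteq> b \<Longrightarrow> par t \<in> S"
    and acyclic: "\<nexists>xs. graph_cycle T xs"
  shows "tree (induced T S)"
proof -
  let ?I = "induced T S"
  have adj: "adjacent ?I u v \<longleftrightarrow> adjacent T u v \<and> u \<in> S \<and> v \<in> S" for u v
    by (auto simp: adjacent_def induced_def)
  have "simple_graph ?I"
    using simple unfolding simple_graph_def induced_def by fastforce
  moreover have "\<nexists>xs. graph_cycle ?I xs"
  proof
    assume "\<exists>xs. graph_cycle ?I xs"
    then obtain xs where "graph_cycle ?I xs" by blast
    then have "graph_cycle T xs"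
      unfolding graph_cycle_def walk_def adj
      by (auto simp: induced_def elim: successively_mono)
    with acyclic show False by blast
  qed
  moreover have "connected_graph ?I"
  proof -
    have up: "\<exists>xs. walk_between ?I t xs b" if "t \<in> verts T \<inter> S" for t using that
    proof (induction "dep t" arbitrary: t rule: less_induct)
      case less
      show ?case
      proof (cases "t = b")
        case True
        then show ?thesis using walk_between_refl[of b ?I] assms(1) by (auto simp: induced_def)
      next
        case False
        have "t \<noteq> r"
        proof
          assume "t = r"
          then show False using assms(2)[OF less(2)] False root_in_sub by auto
        qed
        then have p: "par t \<in> verts T \<inter> S" "dep (par t) < dep t" "adjacent T t (par t)"
          using less(2) par[of t] assms(3)[OF less(2) False] by auto
        from less(1)[OF p(2,1)] obtain xs where "walk_between ?I (par t) xs b" by blast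
        from walk_between_Cons[OF this, of t] show ?thesis
          using p less(2) adj by (auto simp: induced_def)
      qed
    qed
    show ?thesis
      unfolding connected_graph_def
    proof (intro conjI ballI)
      show "verts ?I \<noteq> {}" using assms(1) by (auto simp: induced_def)
      fix u v assume "u \<in> verts ?I" "v \<in> verts ?I"
      then have "u \<in> verts T \<inter> S" "v \<in> verts T \<inter> S" by (simp_all add: induced_def)
      from this[THEN up] obtain xs ys where "walk_between ?I u xs b" "walk_between ?I v ys b"
        by blast
      then show "\<exists>xs. walk_between ?I u xs v"
        using walk_between_append walk_between_rev by metis
    qed
  qed
  ultimately show ?thesis by (simp add: tree_def)
qed

end

text \<open>Any vertex can be the root, with distance as depth and a neighbour one step nearer as
  parent. The work lies in \<open>edge\<close>: an edge of another kind closes a cycle with the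
  parent chains of its ends, followed up to where they first meet.\<close>

lemma tree_rooted:
  assumes "tree T"
  obtains r par dep where "rooted_tree T r par dep"
proof -
  have simple: "simple_graph T" and conn: "connected_graph T" and acyc: "\<nexists>xs. graph_cycle T xs"
    using assms by (auto simp: tree_def)
  from conn obtain r where r: "r \<in> verts T" by (auto simp: connected_graph_def)
  define dep where "dep t = the_enat (gdist T r t)" for t
  have fin: "gdist T r t = enat (dep t)" if "t \<in> verts T" for t
  proof -
    have "\<exists>xs. walk_between T r xs t" using conn r that by (simp add: connected_graph_def)
    then obtain xs where "walk_between T r xs t" ..
    from gdist_le[OF this] have "gdist T r t \<noteq> \<infinity>" by (cases "gdist T r t") simp_all
    then show ?thesis by (auto simp: dep_def)
  qed
  \<comment> \<open>The last but one vertex of a shortest walk from \<open>r\<close> to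
    \<open>t\<close> is one step nearer to \<open>r\<close>.\<close>
  have ex: "\<exists>s. s \<in> verts T \<and> adjacent T t s \<and> dep t = Suc (dep s)" if t: "t \<in> verts T" "t \<noteq> r" for t
  proof -
    have "gdist T r t \<noteq> \<infinity>" using fin[OF t(1)] by simp
    then obtain xs where xs: "walk_between T r xs t" "gdist T r t = enat (length xs - 1)"
      by (rule gdist_walk)
    then have l: "xs \<noteq> []" "last xs = t" "hd xs = r" by (auto simp: walk_between_def walk_def)
    then have "butlast xs \<noteq> []" using t(2) by (cases xs) auto
    then obtain zs s where "butlast xs = zs @ [s]" by (metis append_butlast_last_id)
    then have eq: "xs = zs @ s # [t]" using l append_butlast_last_id[of xs] by simp
    note w = walk_between_split[OF xs(1)[unfolded eq]]
    have a: "adjacent T s t" using w(2) by (simp add: walk_between_def walk_def)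
    have s: "s \<in> verts T" using adjacent_verts[OF simple a] by simp
    have "dep s \<le> length zs" using gdist_le[OF w(1)] fin[OF s] by simp
    moreover have "dep t = Suc (length zs)" using xs(2) fin[OF t(1)] eq by simp
    moreover have "dep t \<le> Suc (dep s)"
    proof -
      have "gdist T s t \<le> enat 1" using gdist_le[OF w(2)] by simp
      then have "enat (dep s) + gdist T s t \<le> enat (dep s) + enat 1" by (rule add_left_mono)
      moreover have "enat (dep t) \<le> enat (dep s) + gdist T s t"
        using gdist_triangle[of T r t s] unfolding fin[OF s] fin[OF t(1)] .
      ultimately have "enat (dep t) \<le> enat (dep s) + enat 1" by (rule order_trans[rotated])
      then show ?thesis by simp
    qed
    ultimately have "dep t = Suc (dep s)" by simp
    then show ?thesis using s a adjacent_sym by metis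
  qed
  define par where "par t = (if t \<in> verts T \<and> t \<noteq> r then SOME s. s \<in> verts T \<and> adjacent T t s \<and> dep t = Suc (dep s) else t)" for t
  have par: "par t \<in> verts T \<and> adjacent T t (par t) \<and> dep t = Suc (dep (par t))"
    if "t \<in> verts T" "t \<noteq> r" for t
    using someI_ex[OF ex[OF that]] that by (simp add: par_def)
  have par_r: "par r = r" by (simp add: par_def)
  have dep_r: "dep r = 0" using gdist_refl[OF r] by (simp add: dep_def zero_enat_def)
  have dep0: "t = r" if "t \<in> verts T" "dep t = 0" for t using par[OF that(1)] that(2) by auto
  \<comment> \<open>The truncated subtraction stays correct past the root, where the chain rests at
    depth 0.\<close>
  have chain: "(par ^^ i) t \<in> verts T \<and> dep ((par ^^ i) t) = dep t - i" if "t \<in> verts T" for t i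
  proof (induction i)
    case (Suc i)
    show ?case
    proof (cases "(par ^^ i) t = r")
      case True
      then have "dep t - i = 0" using Suc dep_r by simp
      then show ?thesis using True r dep_r par_r by simp
    next
      case False
      then show ?thesis using Suc par[of "(par ^^ i) t"] by auto
    qed
  qed (use that in auto)
  have chain_adj: "adjacent T ((par ^^ i) t) ((par ^^ Suc i) t)" if "t \<in> verts T" "i < dep t" for t i
  proof -
    have "(par ^^ i) t \<noteq> r" using chain[OF that(1), of i] that(2) dep_r by auto
    then show ?thesis using par chain[OF that(1), of i] by simp
  qed
  have edge: "s = par t \<and> t \<noteq> r \<or> t = par s \<and> s \<noteq> r" if adj: "adjacent T s t" for s t
  proof (rule ccontr)
    assume no: "\<not> ?thesis"
    have s: "s \<in> verts T" and t: "t \<in> verts T" and st: "s \<noteq> t"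
      using adjacent_verts[OF simple adj] by auto
    define Q where "Q i \<longleftrightarrow> (\<exists>j \<le> dep t. (par ^^ i) s = (par ^^ j) t)" for i
    have "(par ^^ dep s) s = r" "(par ^^ dep t) t = r"
      using chain[OF s, of "dep s"] chain[OF t, of "dep t"] dep0 by auto
    then have "Q (dep s)" unfolding Q_def by (metis order_refl)
    \<comment> \<open>By minimality of \<open>i\<close> the chain of \<open>s\<close> below the
      meeting vertex avoids the chain of \<open>t\<close>.\<close>
    define i where "i = (LEAST i. Q i)"
    have iQ: "Q i" unfolding i_def by (rule LeastI) (rule \<open>Q (dep s)\<close>)
    have i_le: "i \<le> dep s" unfolding i_def by (rule Least_le) (rule \<open>Q (dep s)\<close>)
    have i_min: "\<not> Q a" if "a < i" for a using that unfolding i_def by (rule not_less_Least)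
    from iQ obtain j where j: "j \<le> dep t" "(par ^^ i) s = (par ^^ j) t" by (auto simp: Q_def)
    \<comment> \<open>The meeting vertex belongs to \<open>?xs\<close> only; \<open>?ys\<close>
      stops just below it.\<close>
    let ?xs = "map (\<lambda>a. (par ^^ a) s) [0..<Suc i]" and ?ys = "map (\<lambda>a. (par ^^ a) t) [0..<j]"
    have inj: "a = b" if "x \<in> verts T" "(par ^^ a) x = (par ^^ b) x" "a \<le> dep x" "b \<le> dep x" for a b x
      using chain[OF that(1), of a] chain[OF that(1), of b] that by simp
    have "graph_cycle T (?xs @ rev ?ys)"
      unfolding graph_cycle_def
    proof (intro conjI)
      have "successively (adjacent T) ?xs"
        unfolding successively_conv_nth using chain_adj[OF s] i_le
        by (auto simp del: upt_Suc funpow.simps)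
      moreover have "successively (adjacent T) ?ys"
        unfolding successively_conv_nth using chain_adj[OF t] j(1)
        by (auto simp del: upt_Suc funpow.simps)
      then have "successively (adjacent T) (rev ?ys)"
        by (simp only: successively_rev) (simp add: adjacent_sym[of T])
      moreover have "adjacent T (last ?xs) (hd (rev ?ys))" if "rev ?ys \<noteq> []"
      proof -
        have "j > 0" using that by auto
        then obtain m where m: "j = Suc m" by (cases j) auto
        have "hd (rev ?ys) = (par ^^ m) t" using m by (simp add: hd_rev)
        moreover have "last ?xs = (par ^^ Suc m) t" using j m by simp
        ultimately show ?thesis using chain_adj[OF t, of m] j m adjacent_sym[of T] by simp
      qed
      ultimately have "successively (adjacent T) (?xs @ rev ?ys)"
        unfolding successively_append_iff by blast
      moreover have "set (?xs @ rev ?ys) \<subseteq> verts T" using chain s t by auto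
      moreover have "?xs @ rev ?ys \<noteq> []" by simp
      ultimately show "walk T (?xs @ rev ?ys)" unfolding walk_def by blast
      have "inj_on (\<lambda>a. (par ^^ a) s) {0..<Suc i}" "inj_on (\<lambda>a. (par ^^ a) t) {0..<j}"
        using inj[OF s] inj[OF t] i_le j(1) by (simp_all add: inj_on_def)
      then have "distinct ?xs" "distinct ?ys"
        by (simp_all only: distinct_map distinct_upt set_upt simp_thms)
      moreover have "set ?xs \<inter> set ?ys = {}"
      proof (rule ccontr)
        assume "set ?xs \<inter> set ?ys \<noteq> {}"
        then obtain a b where "a \<in> {0..<Suc i}" "b \<in> {0..<j}" "(par ^^ a) s = (par ^^ b) t"
          unfolding set_map set_upt by blast
        then have ab: "a \<le> i" "b < j" "(par ^^ a) s = (par ^^ b) t" by simp_all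
        then have "Q a" unfolding Q_def using j(1) by (intro exI[of _ b]) simp
        then have "a = i" using i_min[of a] ab(1) by (cases "a < i") simp_all
        then show False using inj[OF t, of b j] ab j by simp
      qed
      ultimately show "distinct (?xs @ rev ?ys)" by simp
      \<comment> \<open>Otherwise \<open>i + j \<le> 1\<close>: then \<open>s = t\<close>, or one of
        them is the parent of the other.\<close>
      show "3 \<le> length (?xs @ rev ?ys)"
      proof (rule ccontr)
        assume "\<not> ?thesis"
        then have "i + j \<le> 1" by simp
        then consider "i = 0" "j = 0" | "i = 1" "j = 0" | "i = 0" "j = 1" by linarith
        then show False
        proof cases
          case 1 then show False using j st by simp
        next
          case 2 then show False using j no i_le dep_r by auto
        next
          case 3 then show False using j no dep_r by auto
        qed
      qed
      have "last (?xs @ rev ?ys) = t"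
        using j by (cases "j = 0") (auto simp: last_rev hd_map upt_conv_Cons)
      moreover have "hd (?xs @ rev ?ys) = s" by (simp add: upt_conv_Cons del: upt_Suc)
      ultimately show "adjacent T (last (?xs @ rev ?ys)) (hd (?xs @ rev ?ys))"
        using adj adjacent_sym[of T] by simp
    qed
    with acyc show False by blast
  qed
  have "rooted_tree T r par dep"
    using simple r par_r dep_r par edge by unfold_locales blast+
  then show ?thesis by (rule that)
qed

subsection \<open>Labelling by balls of decreasing radii\<close>

locale ball_labelling =
  fixes d :: "'a \<Rightarrow> 'a \<Rightarrow> enat" and n k :: nat
  assumes d_sym: "d u v = d v u"
    and d_tri: "d u w \<le> d u v + d v w"
begin

section \<open>Penalised distances and the labelling invariant\<close>

definition kap :: "'a list \<Rightarrow> nat \<Rightarrow> 'a \<Rightarrow> enat" where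
  "kap L i w = d (L ! i) w + enat (i * n)"

text \<open>
  The ball of radius \<open>(k + 1 - i)n\<close> about \<open>L ! i\<close> is the set of \<open>w\<close> with \<open>kap L i w \<le> K\<close>; this form
  avoids the truncated subtraction.
\<close>

definition K :: enat where "K = enat ((k + 1) * n)"

text \<open>A label has to stay active only while some vertex pokes for it: the unlabelled vertex
  nearby will later receive a label that must share a bag with \<open>x\<close>.\<close>

definition poke :: "'a set \<Rightarrow> ('a \<rightharpoonup> 'a) \<Rightarrow> 'a \<Rightarrow> 'a \<Rightarrow> bool" where
  "poke D f x v \<longleftrightarrow> v \<in> D \<and> f v = Some x \<and> (\<exists>u \<in> D - dom f. d u v \<le> enat n)"

text \<open>
  In the condition on \<open>i < i'\<close> the equation says that \<open>w\<close> lies on a geodesic from \<open>L ! i'\<close> to \<open>v\<close>. It is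
  what turns the ownership of a vertex \<open>w\<close> of the adhesion set by a later label into a bound on the
  distance of the deleted label's part from that later label.
\<close>

definition lab_inv :: "'a set \<Rightarrow> 'a list \<Rightarrow> ('a \<rightharpoonup> 'a) \<Rightarrow> bool" where
  "lab_inv D L f \<longleftrightarrow>
     distinct L \<and> length L \<le> k + 1 \<and>
     (\<forall>i < length L. \<forall>v \<in> D. kap L i v \<le> K \<longrightarrow> v \<in> dom f) \<and>
     (\<forall>i < length L. \<forall>v \<in> D. f v = Some (L ! i) \<longrightarrow> kap L i v \<le> K) \<and>
     (\<forall>i' < length L. \<forall>i < i'. \<forall>v w. poke D f (L ! i') v \<longrightarrow>
        d (L ! i') w + d w v = d (L ! i') v \<longrightarrow> kap L i' w \<le> kap L i w) \<and>
     (\<forall>x v. poke D f x v \<longrightarrow> x \<in> set L) \<and>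
     (\<forall>v x. f v = Some x \<longrightarrow> d x v \<le> K \<and> (x \<in> D \<longrightarrow> x \<in> set L))"

lemma lab_invI:
  assumes "distinct L" "length L \<le> k + 1"
    and "\<And>i v. i < length L \<Longrightarrow> v \<in> D \<Longrightarrow> kap L i v \<le> K \<Longrightarrow> v \<in> dom f"
    and "\<And>i v. i < length L \<Longrightarrow> v \<in> D \<Longrightarrow> f v = Some (L ! i) \<Longrightarrow> kap L i v \<le> K"
    and "\<And>i i' v w. i' < length L \<Longrightarrow> i < i' \<Longrightarrow> poke D f (L ! i') v \<Longrightarrow>
        d (L ! i') w + d w v = d (L ! i') v \<Longrightarrow> kap L i' w \<le> kap L i w"
    and "\<And>x v. poke D f x v \<Longrightarrow> x \<in> set L"
    and "\<And>v x. f v = Some x \<Longrightarrow> d x v \<le> K"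
    and "\<And>v x. f v = Some x \<Longrightarrow> x \<in> D \<Longrightarrow> x \<in> set L"
  shows "lab_inv D L f"
  unfolding lab_inv_def using assms by blast

lemma lab_invD:
  assumes "lab_inv D L f"
  shows "distinct L" "length L \<le> k + 1"
    and "\<And>i v. i < length L \<Longrightarrow> v \<in> D \<Longrightarrow> kap L i v \<le> K \<Longrightarrow> v \<in> dom f"
    and "\<And>i v. i < length L \<Longrightarrow> v \<in> D \<Longrightarrow> f v = Some (L ! i) \<Longrightarrow> kap L i v \<le> K"
    and "\<And>i i' v w. i' < length L \<Longrightarrow> i < i' \<Longrightarrow> poke D f (L ! i') v \<Longrightarrow>
        d (L ! i') w + d w v = d (L ! i') v \<Longrightarrow> kap L i' w \<le> kap L i w"
    and "\<And>x v. poke D f x v \<Longrightarrow> x \<in> set L"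
    and "\<And>v x. f v = Some x \<Longrightarrow> d x v \<le> K"
    and "\<And>v x. f v = Some x \<Longrightarrow> x \<in> D \<Longrightarrow> x \<in> set L"
  using assms unfolding lab_inv_def by blast+

lemma poke_mono: "poke D' f x v \<Longrightarrow> D' \<subseteq> D \<Longrightarrow> poke D f x v"
  unfolding poke_def by blast

lemma lab_inv_mono:
  assumes "lab_inv D L f" and "D' \<subseteq> D"
  shows "lab_inv D' L f"
proof (rule lab_invI)
  note I = lab_invD[OF assms(1)]
  note pk = poke_mono[OF _ assms(2)]
  show "distinct L" "length L \<le> k + 1" by (fact I)+
  show "v \<in> dom f" if "i < length L" "v \<in> D'" "kap L i v \<le> K" for i v
    using I(3) that assms(2) by blast
  show "kap L i v \<le> K" if "i < length L" "v \<in> D'" "f v = Some (L ! i)" for i v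
    using I(4) that assms(2) by blast
  show "kap L i' w \<le> kap L i w" if "i' < length L" "i < i'" "poke D' f (L ! i') v"
      "d (L ! i') w + d w v = d (L ! i') v" for i i' v w
    using I(5)[OF that(1,2) pk[OF that(3)] that(4)] .
  show "x \<in> set L" if "poke D' f x v" for x v using I(6)[OF pk[OF that]] .
  show "d x v \<le> K" if "f v = Some x" for v x using I(7)[OF that] .
  show "x \<in> set L" if "f v = Some x" "x \<in> D'" for v x using I(8)[OF that(1)] that(2) assms(2) by blast
qed

lemma lab_inv_empty: "lab_inv D [] Map.empty"
  by (rule lab_invI) (auto simp: poke_def)

lemma kap_tri: "kap L i v \<le> kap L i w + d w v"
  unfolding kap_def using d_tri[of "L ! i" v w]
  by (metis add.assoc add.commute add_right_mono)

lemma kap_geodesic: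
  assumes "d (L ! i) w + d w v = d (L ! i) v"
  shows "kap L i w + d w v = kap L i v"
  unfolding kap_def using assms by (metis add.assoc add.commute)

lemma d_le_kap: "d (L ! i) v \<le> kap L i v"
  unfolding kap_def by simp

lemma K_finite: "K \<noteq> \<infinity>"
  by (simp add: K_def)

text \<open>Going back from \<open>v\<close> to \<open>w\<close> lowers \<open>kap L i'\<close> by
  exactly \<open>d w v\<close> and \<open>kap L i\<close> by at most that much. The bound by
  \<open>K\<close> makes \<open>d w v\<close> finite, so that it cancels. Thus the ownership
  condition of \<open>lab_inv\<close> need only be compared at the poking vertex.\<close>

lemma kap_geodesic_mono:
  assumes "d (L ! i') w + d w v = d (L ! i') v" and "kap L i' v \<le> kap L i v"
    and "kap L i' v \<le> K"
  shows "kap L i' w \<le> kap L i w"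
proof -
  have "d w v + kap L i' w \<le> d w v + kap L i w"
    using kap_geodesic[OF assms(1)] assms(2) kap_tri[of L i v w]
    by (metis add.commute order_trans)
  moreover have "d w v \<noteq> \<infinity>"
    using kap_geodesic[OF assms(1)] assms(3) K_finite by (metis enat_ord_simps(5) plus_enat_simps(3))
  ultimately show ?thesis by (simp add: enat_add_left_cancel_le)
qed

section \<open>Deleting a label\<close>

lemma kap_delete_less: "i < i0 \<Longrightarrow> i0 < length L \<Longrightarrow> kap (take i0 L @ drop (Suc i0) L) i w = kap L i w"
  by (simp add: kap_def nth_append)

lemma nth_delete_ge:
  "i0 \<le> i \<Longrightarrow> Suc i < length L \<Longrightarrow> (take i0 L @ drop (Suc i0) L) ! i = L ! Suc i"
  by (simp add: nth_append)

lemma kap_delete_ge: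
  assumes "i0 \<le> i" "Suc i < length L"
  shows "kap L (Suc i) w = kap (take i0 L @ drop (Suc i0) L) i w + enat n"
  using nth_delete_ge[OF assms]
  by (simp add: kap_def add.commute add.left_commute flip: plus_enat_simps(1))

text \<open>\<open>dom\<close> expresses that the label at \<open>i0\<close> owns nothing: whatever
  \<open>j\<close> in \<open>A\<close> it uses to reach a poking vertex is also used by a later
  label. Growing the later labels by \<open>n\<close> labels everything near the part of
  \<open>L ! i0\<close>, which then pokes no more.\<close>

lemma delete_label:
  assumes inv: "lab_inv D L f" and i0: "i0 < length L" and LD: "set L \<inter> D = {}"
    and sep: "\<And>u x. u \<in> D \<Longrightarrow> x \<in> set L \<Longrightarrow> d x u \<noteq> \<infinity> \<Longrightarrow> \<exists>j \<in> A. d x j + d j u = d x u"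
    and dom: "\<And>j v. j \<in> A \<Longrightarrow> poke D f (L ! i0) v \<Longrightarrow> d (L ! i0) j + d j v = d (L ! i0) v \<Longrightarrow>
      \<exists>i v'. i0 < i \<and> i < length L \<and> poke D f (L ! i) v' \<and> d (L ! i) j + d j v' = d (L ! i) v'"
  shows "\<exists>f'. lab_inv D (take i0 L @ drop (Suc i0) L) f' \<and> f \<subseteq>\<^sub>m f' \<and>
      (\<forall>v x. v \<notin> dom f \<longrightarrow> f' v = Some x \<longrightarrow> v \<in> D \<and> x \<in> set L)"
proof -
  note I = lab_invD[OF inv]
  let ?L = "take i0 L @ drop (Suc i0) L"
  define S where "S = {i0<..<length L}"
  \<comment> \<open>Labels after \<open>i0\<close> move up one place, so in the old numbering their
    grown balls are bounded by \<open>K + enat n\<close>.\<close>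
  define hit where "hit u \<longleftrightarrow> (\<exists>i \<in> S. kap L i u \<le> K + enat n)" for u
  \<comment> \<open>Taking the least \<open>kap\<close> is what later proves the ownership condition
    for newly labelled vertices.\<close>
  define own where "own u = (SOME i. is_arg_min (\<lambda>i. kap L i u) (\<lambda>i. i \<in> S) i)" for u
  have own: "own u \<in> S \<and> (\<forall>i \<in> S. kap L (own u) u \<le> kap L i u)" if "hit u" for u
  proof -
    have "finite S" "S \<noteq> {}" using that by (auto simp: S_def hit_def)
    from ex_is_arg_min_if_finite[OF this, of "\<lambda>i. kap L i u"]
    have "is_arg_min (\<lambda>i. kap L i u) (\<lambda>i. i \<in> S) (own u)"
      unfolding own_def by (rule someI_ex)
    then show ?thesis by (auto simp: is_arg_min_linorder)
  qed
  define f' where "f' u = (if u \<in> dom f then f u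
      else if u \<in> D \<and> hit u then Some (L ! own u) else None)" for u
  have dom': "u \<in> dom f' \<longleftrightarrow> u \<in> dom f \<or> u \<in> D \<and> hit u" for u
    by (auto simp: f'_def domIff)
  have old: "f' u = f u" if "u \<in> dom f" for u using that by (simp add: f'_def)
  have new: "u \<in> D \<and> hit u \<and> x = L ! own u" if "u \<notin> dom f" "f' u = Some x" for u x
    using that by (auto simp: f'_def split: if_splits)
  have len: "length ?L = length L - 1" using i0 by simp
  have setL: "set ?L = set L - {L ! i0}"
  proof -
    have "distinct (take i0 L @ L ! i0 # drop (Suc i0) L)"
      using I(1) id_take_nth_drop[OF i0] by simp
    moreover have "set L = set (take i0 L @ L ! i0 # drop (Suc i0) L)"
      using id_take_nth_drop[OF i0] by simp
    ultimately show ?thesis by auto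
  qed
  have distinct': "distinct ?L"
  proof -
    have "distinct (take i0 L @ L ! i0 # drop (Suc i0) L)"
      using I(1) id_take_nth_drop[OF i0] by simp
    then show ?thesis by simp
  qed
  have shift: "kap ?L i w \<le> K \<longleftrightarrow> kap L (Suc i) w \<le> K + enat n"
    if "i0 \<le> i" "Suc i < length L" for i w
    unfolding kap_delete_ge[OF that] by (simp add: add.commute[of _ "enat n"] enat_add_left_cancel_le)
  have poke_old: "poke D f x v" if "poke D f' x v" "v \<in> dom f" for x v
  proof -
    from that(1) obtain u where "v \<in> D" "f' v = Some x" "u \<in> D" "u \<notin> dom f'" "d u v \<le> enat n"
      unfolding poke_def by blast
    moreover from this have "u \<notin> dom f" using dom'[of u] by simp
    ultimately show ?thesis using old[OF that(2)] unfolding poke_def by auto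
  qed
  \<comment> \<open>After the expansion a vertex that was labelled before by an expanded label no longer has
     an unlabelled vertex nearby.\<close>
  have no_old: False if "poke D f' (L ! i) v" "v \<in> dom f" "i0 < i" "i < length L" for i v
  proof -
    from that(1) obtain u where u: "u \<in> D" "u \<notin> dom f'" "d u v \<le> enat n"
      unfolding poke_def by blast
    have v: "v \<in> D" "f v = Some (L ! i)"
      using poke_old[OF that(1,2)] by (simp_all add: poke_def)
    have "kap L i u \<le> kap L i v + d v u" by (rule kap_tri)
    also have "\<dots> \<le> K + enat n"
      using I(4)[OF that(4) v] u(3) by (simp add: add_mono d_sym[of v u])
    finally have "hit u" using that by (auto simp: hit_def S_def)
    with u dom' show False by blast
  qed
  have "lab_inv D ?L f'"
  proof (rule lab_invI)
    show "length ?L \<le> k + 1" using I(2) len by simp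
  next
    fix i v assume i: "i < length ?L" and v: "v \<in> D" "kap ?L i v \<le> K"
    show "v \<in> dom f'"
    proof (cases "i < i0")
      case True
      then show ?thesis using I(3)[of i v] i0 v kap_delete_less[OF True i0] dom' by auto
    next
      case False
      then have "kap L (Suc i) v \<le> K + enat n" using shift[of i v] v i len by simp
      then have "hit v" using False i len by (auto simp: hit_def S_def)
      then show ?thesis using dom' v by blast
    qed
  next
    fix i v assume i: "i < length ?L" and v: "v \<in> D" "f' v = Some (?L ! i)"
    show "kap ?L i v \<le> K"
    proof (cases "v \<in> dom f")
      case True
      then have fv: "f v = Some (?L ! i)" using v old by simp
      show ?thesis
      proof (cases "i < i0")
        case True
        then show ?thesis using I(4)[of i v] i0 v fv kap_delete_less[OF True i0] by (simp add: nth_append)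
      next
        case False
        then have *: "i0 \<le> i" "Suc i < length L" using i len by auto
        have "kap L (Suc i) v \<le> K" using I(4)[OF *(2) v(1)] fv nth_delete_ge[OF *] by simp
        then show ?thesis unfolding shift[OF *] by (simp add: add_increasing2)
      qed
    next
      case False
      from new[OF False v(2)] have h: "hit v" and eq: "?L ! i = L ! own v" by auto
      from own[OF h] have o: "i0 < own v" "own v < length L"
        "\<And>i. i \<in> S \<Longrightarrow> kap L (own v) v \<le> kap L i v" by (auto simp: S_def)
      have "?L ! (own v - 1) = L ! own v" using o nth_delete_ge[of i0 "own v - 1" L] by simp
      then have "i = own v - 1"
        using eq distinct' i o len by (metis diff_less_mono nth_eq_iff_index_eq Suc_leI One_nat_def
            less_nat_zero_code not_less_zero bot_nat_0.not_eq_extremum Suc_le_eq)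
      then have *: "i0 \<le> i" "Suc i = own v" using o by auto
      have "kap L (own v) v \<le> K + enat n" using h o(3) by (auto simp: hit_def intro: order_trans)
      then show ?thesis using shift[of i v] * o by simp
    qed
  next
    fix i i' v w
    assume i': "i' < length ?L" and i: "i < i'" and p: "poke D f' (?L ! i') v"
      and geo: "d (?L ! i') w + d w v = d (?L ! i') v"
    show "kap ?L i' w \<le> kap ?L i w"
    proof (cases "i' < i0")
      case True
      \<comment> \<open>Newly labelled vertices carry labels from places after \<open>i0\<close>;
        hence a poking vertex of an earlier label is an old one, and the old invariant
        applies.\<close>
      have "v \<in> dom f"
      proof (rule ccontr)
        assume nv: "v \<notin> dom f"
        have "f' v = Some (L ! i')" using p True i0 by (auto simp: poke_def nth_append)
        from new[OF nv this] own[of v] have "L ! i' = L ! own v" "i0 < own v" "own v < length L"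
          by (auto simp: S_def)
        then show False using I(1) True i0 by (simp add: nth_eq_iff_index_eq)
      qed
      then have "poke D f (L ! i') v" using poke_old p True i0 by (simp add: nth_append)
      then show ?thesis using I(5)[of i' i v w] geo i True i0
        by (simp add: kap_delete_less nth_append)
    next
      case False
      then have *: "i0 \<le> i'" "Suc i' < length L" using i' len by auto
      \<comment> \<open>For a grown label the situation is the opposite: by \<open>no_old\<close>
        only newly labelled vertices can poke.\<close>
      have nv: "v \<notin> dom f"
        using no_old[of "Suc i'" v] p * nth_delete_ge[OF *] by auto
      have fv: "f' v = Some (L ! Suc i')" "v \<in> D" using p nth_delete_ge[OF *] by (auto simp: poke_def)
      from new[OF nv fv(1)] have h: "hit v" and eq: "L ! Suc i' = L ! own v" by auto
      from own[OF h] have o: "i0 < own v" "own v < length L"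
        "\<And>i. i \<in> S \<Longrightarrow> kap L (own v) v \<le> kap L i v" by (auto simp: S_def)
      have ow: "own v = Suc i'" using eq I(1) o * by (simp add: nth_eq_iff_index_eq)
      have le: "kap ?L i' v \<le> K"
        using h o(3) shift[OF *] by (auto simp: hit_def ow intro: order_trans)
      \<comment> \<open>Labels before \<open>i0\<close> have not grown, and their \<open>kap\<close>
        at \<open>v\<close> exceeds \<open>K\<close> because \<open>v\<close> was unlabelled. Among
        the grown labels \<open>own v\<close> has the least \<open>kap\<close>.\<close>
      have "kap ?L i' v \<le> kap ?L i v"
      proof (cases "i < i0")
        case True
        have "\<not> kap L i v \<le> K" using I(3)[of i v] nv fv True i0 by auto
        then show ?thesis using le kap_delete_less[OF True i0, of v] by (simp add: order_trans)
      next
        case False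
        then have **: "i0 \<le> i" "Suc i < length L" using i * by auto
        have "kap L (Suc i') v \<le> kap L (Suc i) v" using o(3)[of "Suc i"] ** ow by (simp add: S_def)
        then show ?thesis unfolding kap_delete_ge[OF *] kap_delete_ge[OF **]
          by (simp add: add.commute[of _ "enat n"] enat_add_left_cancel_le)
      qed
      then show ?thesis using kap_geodesic_mono[OF geo _ le] by blast
    qed
  next
    fix x v assume p: "poke D f' x v"
    show "x \<in> set ?L"
    proof (cases "v \<in> dom f")
      case False
      have "f' v = Some x" using p by (simp add: poke_def)
      from new[OF False this] own[of v] have "x = L ! own v" "own v \<in> S" by auto
      then show ?thesis using setL I(1) i0 by (auto simp: S_def nth_eq_iff_index_eq)
    next
      case True
      have pf: "poke D f x v" using poke_old[OF p True] .
      have xL: "x \<in> set L" using I(6)[OF pf] .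
      \<comment> \<open>Suppose the deleted label still poked at \<open>v\<close>. Some later label
        \<open>i\<close> shares its gate \<open>j\<close>, so
        \<open>kap L i j \<le> kap L i0 j\<close>. Continuing from \<open>j\<close> over
        \<open>v\<close> to the unlabelled \<open>u\<close> costs at most \<open>K + enat n\<close>
        in total, so \<open>u\<close> was hit.\<close>
      moreover have False if x: "x = L ! i0"
      proof -
        from p obtain u where u: "u \<in> D" "u \<notin> dom f'" "d u v \<le> enat n"
          unfolding poke_def by blast
        have v: "v \<in> D" "f v = Some x" using pf by (simp_all add: poke_def)
        have kv: "kap L i0 v \<le> K" using I(4)[OF i0 v(1)] v(2) x by simp
        then have "d x v \<noteq> \<infinity>"
          using d_le_kap[of L i0 v] K_finite x by (metis enat_ord_simps(5) order_trans)
        from sep[OF v(1) xL this] obtain j where j: "j \<in> A" "d x j + d j v = d x v" by blast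
        from dom[OF j(1)] pf j(2) x obtain i v' where i: "i0 < i" "i < length L"
          "poke D f (L ! i) v'" "d (L ! i) j + d j v' = d (L ! i) v'" by blast
        have "kap L i u \<le> kap L i j + (d j v + d v u)"
          using kap_tri[of L i u j] d_tri[of j u v] by (meson add_left_mono order_trans)
        also have "\<dots> \<le> kap L i0 j + (d j v + d v u)"
          using I(5)[OF i(2,1,3,4)] by (simp add: add_right_mono)
        also have "\<dots> = kap L i0 v + d v u"
          using kap_geodesic[of L i0 j v] j(2) x by (metis add.assoc)
        also have "\<dots> \<le> K + enat n" using kv u(3) by (simp add: add_mono d_sym[of v u])
        finally have "hit u" using i by (auto simp: hit_def S_def)
        with u dom' show False by blast
      qed
      ultimately show ?thesis using setL by blast
    qed
  next
    fix v x assume fv: "f' v = Some x"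
    show "d x v \<le> K"
    proof (cases "v \<in> dom f")
      case True then show ?thesis using I(7) fv old by auto
    next
      case False
      from new[OF False fv] own[of v] have o: "hit v" "x = L ! own v" "own v \<in> S"
        "\<And>i. i \<in> S \<Longrightarrow> kap L (own v) v \<le> kap L i v" by auto
      have "kap L (own v) v \<le> K + enat n" using o by (auto simp: hit_def intro: order_trans)
      moreover obtain m where m: "own v = Suc m" using o(3) by (cases "own v") (auto simp: S_def)
      moreover have *: "i0 \<le> m" "Suc m < length L" using o(3) m by (auto simp: S_def)
      ultimately have "kap ?L m v \<le> K" using shift by simp
      moreover have "?L ! m = x" using nth_delete_ge[OF *] o(2) m by simp
      ultimately show ?thesis using d_le_kap[of ?L m v] by simp
    qed
    assume xD: "x \<in> D"
    have "x \<in> set L"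
      using I(8)[of v x] new[of v x] own[of v] fv xD old[of v]
      by (cases "v \<in> dom f") (auto simp: S_def)
    with LD xD show "x \<in> set ?L" by blast
  qed (rule distinct')
  moreover have "f \<subseteq>\<^sub>m f'" by (auto simp: map_le_def old)
  moreover have "v \<in> D \<and> x \<in> set L" if "v \<notin> dom f" "f' v = Some x" for v x
    using new[OF that] own[of v] by (auto simp: S_def)
  ultimately show ?thesis by blast
qed

text \<open>Pigeonhole: if every label were the last one satisfying \<open>Q\<close> for some
  element of \<open>A\<close>, choosing such an element would inject the labels into
  \<open>A\<close>.\<close>

lemma unowned_label:
  assumes "finite A" and "card A < length L"
  shows "\<exists>i0 < length L. \<forall>j \<in> A. Q i0 j \<longrightarrow> (\<exists>i. i0 < i \<and> i < length L \<and> Q i j)"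
proof (rule ccontr)
  assume "\<not> ?thesis"
  then have "\<forall>i \<in> {..<length L}. \<exists>j. j \<in> A \<and> Q i j \<and> (\<forall>i'. i < i' \<and> i' < length L \<longrightarrow> \<not> Q i' j)"
    by blast
  then obtain g where g: "\<And>i. i < length L \<Longrightarrow> g i \<in> A \<and> Q i (g i) \<and>
      (\<forall>i'. i < i' \<and> i' < length L \<longrightarrow> \<not> Q i' (g i))"
    by (metis bchoice lessThan_iff)
  have "inj_on g {..<length L}"
    by (rule inj_onI) (metis g lessThan_iff linorder_neqE_nat)
  moreover have "g ` {..<length L} \<subseteq> A" using g by auto
  ultimately have "card {..<length L} \<le> card A" using assms(1) card_inj_on_le by blast
  with assms(2) show False by simp
qed

text \<open>Deletion is iterated, each round shortening the list by one. The clause on newly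
  labelled vertices is carried along because \<open>ext_exists\<close> compares the labels of close
  vertices with it.\<close>

lemma reduce_labels:
  assumes "lab_inv D L f" and "set L \<inter> D = {}" and "finite A"
    and "\<And>u x. u \<in> D \<Longrightarrow> x \<in> set L \<Longrightarrow> d x u \<noteq> \<infinity> \<Longrightarrow> \<exists>j \<in> A. d x j + d j u = d x u"
  shows "\<exists>L' f'. lab_inv D L' f' \<and> length L' \<le> card A \<and> set L' \<subseteq> set L \<and> f \<subseteq>\<^sub>m f' \<and>
      (\<forall>v x. v \<notin> dom f \<longrightarrow> f' v = Some x \<longrightarrow> v \<in> D \<and> x \<in> set L)"
  using assms
proof (induction "length L" arbitrary: L f rule: less_induct)
  case less
  show ?case
  proof (cases "length L \<le> card A")
    case True
    show ?thesis
      by (rule exI[of _ L], rule exI[of _ f]) (use True less.prems in \<open>auto simp: domIff\<close>)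
  next
    case False
    then have "card A < length L" by simp
    from unowned_label[OF less.prems(3) this, of
        "\<lambda>i j. \<exists>v. poke D f (L ! i) v \<and> d (L ! i) j + d j v = d (L ! i) v"]
    obtain i0 where i0: "i0 < length L"
      and own: "\<And>j. j \<in> A \<Longrightarrow> \<exists>v. poke D f (L ! i0) v \<and> d (L ! i0) j + d j v = d (L ! i0) v \<Longrightarrow>
        \<exists>i. i0 < i \<and> i < length L \<and> (\<exists>v. poke D f (L ! i) v \<and> d (L ! i) j + d j v = d (L ! i) v)"
      by blast
    let ?L = "take i0 L @ drop (Suc i0) L"
    have "\<exists>f'. lab_inv D ?L f' \<and> f \<subseteq>\<^sub>m f' \<and>
        (\<forall>v x. v \<notin> dom f \<longrightarrow> f' v = Some x \<longrightarrow> v \<in> D \<and> x \<in> set L)"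
    proof (rule delete_label[OF less.prems(1) i0 less.prems(2) less.prems(4)])
      fix j v assume "j \<in> A" "poke D f (L ! i0) v" "d (L ! i0) j + d j v = d (L ! i0) v"
      then show "\<exists>i v'. i0 < i \<and> i < length L \<and> poke D f (L ! i) v' \<and>
          d (L ! i) j + d j v' = d (L ! i) v'"
        using own[of j] by blast
    qed
    then
    obtain f1 where f1: "lab_inv D ?L f1" "f \<subseteq>\<^sub>m f1"
      "\<And>v x. v \<notin> dom f \<Longrightarrow> f1 v = Some x \<Longrightarrow> v \<in> D \<and> x \<in> set L" by blast
    have sub: "set ?L \<subseteq> set L" by (auto dest: in_set_takeD in_set_dropD)
    have "length ?L < length L" using i0 by simp
    from less.hyps[OF this f1(1)] less.prems sub
    obtain L' f' where f': "lab_inv D L' f'" "length L' \<le> card A" "set L' \<subseteq> set ?L" "f1 \<subseteq>\<^sub>m f'"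
      "\<And>v x. v \<notin> dom f1 \<Longrightarrow> f' v = Some x \<Longrightarrow> v \<in> D \<and> x \<in> set ?L"
      by (smt (verit) disjoint_iff in_mono)
    have "v \<in> D \<and> x \<in> set L" if "v \<notin> dom f" "f' v = Some x" for v x
    proof (cases "v \<in> dom f1")
      case True
      then have "f1 v = Some x" using f'(4) that(2) by (simp add: map_le_def)
      then show ?thesis using f1(3) that(1) by blast
    next
      case False
      then show ?thesis using f'(5) that(2) sub by blast
    qed
    then show ?thesis
      using f' sub map_le_trans[OF f1(2) f'(4)] by blast
  qed
qed

section \<open>Appending new labels\<close>

lemma kap_append_less: "i < length L \<Longrightarrow> kap (L @ [c]) i w = kap L i w"
  by (simp add: kap_def nth_append)

text \<open>The new label takes the last place and claims only unlabelled vertices. Since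
  \<open>length L \<le> k\<close>, its radius is at least \<open>n\<close>, so no vertex of
  \<open>D\<close> close to \<open>c\<close> stays unlabelled.\<close>

lemma append_label:
  assumes inv: "lab_inv D L f" and len: "length L \<le> k" and c: "c \<in> D" "c \<notin> set L"
  shows "\<exists>f'. lab_inv D (L @ [c]) f' \<and> f \<subseteq>\<^sub>m f' \<and>
      (\<forall>v x. v \<notin> dom f \<longrightarrow> f' v = Some x \<longrightarrow> v \<in> D \<and> x = c) \<and>
      (\<forall>u \<in> D. d c u \<le> enat n \<longrightarrow> u \<in> dom f')"
proof -
  note I = lab_invD[OF inv]
  let ?L = "L @ [c]" and ?N = "length L"
  define f' where "f' u = (if u \<in> dom f then f u
      else if u \<in> D \<and> kap ?L ?N u \<le> K then Some c else None)" for u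
  have dom': "u \<in> dom f' \<longleftrightarrow> u \<in> dom f \<or> u \<in> D \<and> kap ?L ?N u \<le> K" for u
    by (auto simp: f'_def domIff)
  have old: "f' u = f u" if "u \<in> dom f" for u using that by (simp add: f'_def)
  have new: "u \<in> D \<and> kap ?L ?N u \<le> K \<and> x = c" if "u \<notin> dom f" "f' u = Some x" for u x
    using that by (auto simp: f'_def split: if_splits)
  \<comment> \<open>A label lying in \<open>D\<close> that is already in use must be active, by the
    last clause of \<open>lab_inv\<close>; \<open>c\<close> is in \<open>D\<close> but not in
    \<open>L\<close>.\<close>
  have fresh: "f v \<noteq> Some c" for v using I(8) c by blast
  have poke_old: "poke D f x v" if "poke D f' x v" "v \<in> dom f" for x v
  proof -
    from that(1) obtain u where "v \<in> D" "f' v = Some x" "u \<in> D" "u \<notin> dom f'" "d u v \<le> enat n"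
      unfolding poke_def by blast
    moreover from this have "u \<notin> dom f" using dom'[of u] by simp
    ultimately show ?thesis using old[OF that(2)] unfolding poke_def by auto
  qed
  have "lab_inv D ?L f'"
  proof (rule lab_invI)
    show "distinct ?L" using I(1) c by simp
    show "length ?L \<le> k + 1" using len by simp
  next
    fix i v assume "i < length ?L" "v \<in> D" "kap ?L i v \<le> K"
    then show "v \<in> dom f'"
      using I(3)[of i v] dom'[of v] kap_append_less[of i L c v] by (cases "i = ?N") auto
  next
    fix i v assume i: "i < length ?L" and v: "v \<in> D" "f' v = Some (?L ! i)"
    show "kap ?L i v \<le> K"
    proof (cases "v \<in> dom f")
      case True
      then have "f v = Some (?L ! i)" using v old by simp
      moreover from this fresh have "i < ?N" using i by (metis length_append_singleton less_SucE nth_append_length)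
      ultimately show ?thesis using I(4)[of i v] v by (simp add: kap_append_less nth_append)
    next
      case False
      from new[OF this v(2)] have "kap ?L ?N v \<le> K" "?L ! i = c" by auto
      moreover have "i = ?N" using calculation(2) i c(2) by (auto simp: nth_append split: if_splits)
      ultimately show ?thesis by simp
    qed
  next
    fix i i' v w
    assume i': "i' < length ?L" and i: "i < i'" and p: "poke D f' (?L ! i') v"
      and geo: "d (?L ! i') w + d w v = d (?L ! i') v"
    show "kap ?L i' w \<le> kap ?L i w"
    proof (cases "v \<in> dom f")
      case True
      have p': "poke D f (?L ! i') v" using poke_old[OF p True] .
      then have "i' < ?N"
        using fresh i' by (metis length_append_singleton less_SucE nth_append_length poke_def)
      then show ?thesis using I(5)[of i' i v w] p' geo i by (simp add: kap_append_less nth_append)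
    next
      case False
      from p have fv: "f' v = Some (?L ! i')" "v \<in> D" by (auto simp: poke_def)
      from new[OF False fv(1)] have le: "kap ?L ?N v \<le> K" and eq: "?L ! i' = c" by auto
      have N: "i' = ?N" using eq i' c(2) by (auto simp: nth_append split: if_splits)
      \<comment> \<open>An unlabelled vertex lies outside the balls of all earlier labels, while
        \<open>v\<close> is inside that of \<open>c\<close>.\<close>
      have "\<not> kap L i v \<le> K" using I(3)[of i v] False fv i N by auto
      then have "kap ?L i' v \<le> kap ?L i v" using le i N by (simp add: kap_append_less)
      then show ?thesis using kap_geodesic_mono[OF geo] le N by blast
    qed
  next
    fix x v assume p: "poke D f' x v"
    show "x \<in> set ?L"
    proof (cases "v \<in> dom f")
      case True
      then show ?thesis using I(6) poke_old[OF p] by auto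
    next
      case False
      then show ?thesis using new[of v x] p by (auto simp: poke_def)
    qed
  next
    fix v x assume fv: "f' v = Some x"
    show "d x v \<le> K"
      using I(7)[of v x] new[of v x] fv old[of v] d_le_kap[of ?L ?N v]
      by (cases "v \<in> dom f") (auto intro: order_trans)
    assume "x \<in> D"
    then show "x \<in> set ?L"
      using I(8)[of v x] new[of v x] fv old[of v] by (cases "v \<in> dom f") auto
  qed
  moreover have "f \<subseteq>\<^sub>m f'" by (auto simp: map_le_def old)
  moreover have "v \<in> D \<and> x = c" if "v \<notin> dom f" "f' v = Some x" for v x
    using new[OF that] by simp
  moreover have "u \<in> dom f'" if "u \<in> D" "d c u \<le> enat n" for u
  proof -
    have "kap ?L ?N u \<le> enat n + enat (?N * n)"
      unfolding kap_def nth_append_length using that(2) by (rule add_right_mono)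
    also have "\<dots> \<le> K" using len by (simp add: K_def)
    finally show ?thesis using dom' that(1) by blast
  qed
  ultimately show ?thesis by blast
qed

lemma append_labels:
  assumes "lab_inv D L f" and "length L + length cs \<le> k + 1"
    and "set cs \<subseteq> D" and "distinct cs" and "set cs \<inter> set L = {}"
  shows "\<exists>f'. lab_inv D (L @ cs) f' \<and> f \<subseteq>\<^sub>m f' \<and>
      (\<forall>v x. v \<notin> dom f \<longrightarrow> f' v = Some x \<longrightarrow> v \<in> D \<and> x \<in> set cs) \<and>
      (\<forall>c \<in> set cs. \<forall>u \<in> D. d c u \<le> enat n \<longrightarrow> u \<in> dom f')"
  using assms
proof (induction cs arbitrary: L f)
  case Nil
  then show ?case by (intro exI[of _ f]) (auto simp: domIff)
next
  case (Cons c cs)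
  have "length L \<le> k" "c \<in> D" "c \<notin> set L" using Cons.prems by auto
  from append_label[OF Cons.prems(1) this] obtain f1 where
    f1: "lab_inv D (L @ [c]) f1" "f \<subseteq>\<^sub>m f1"
      "\<And>v x. v \<notin> dom f \<Longrightarrow> f1 v = Some x \<Longrightarrow> v \<in> D \<and> x = c"
      "\<And>u. u \<in> D \<Longrightarrow> d c u \<le> enat n \<Longrightarrow> u \<in> dom f1" by blast
  from Cons.IH[OF f1(1)] Cons.prems obtain f' where
    f': "lab_inv D ((L @ [c]) @ cs) f'" "f1 \<subseteq>\<^sub>m f'"
      "\<And>v x. v \<notin> dom f1 \<Longrightarrow> f' v = Some x \<Longrightarrow> v \<in> D \<and> x \<in> set cs"
      "\<And>c u. c \<in> set cs \<Longrightarrow> u \<in> D \<Longrightarrow> d c u \<le> enat n \<Longrightarrow> u \<in> dom f'"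
    by auto
  have "v \<in> D \<and> x \<in> set (c # cs)" if "v \<notin> dom f" "f' v = Some x" for v x
  proof (cases "v \<in> dom f1")
    case True
    then have "f1 v = Some x" using f'(2) that(2) by (simp add: map_le_def)
    then show ?thesis using f1(3)[OF that(1)] by simp
  next
    case False
    then show ?thesis using f'(3)[OF False that(2)] by simp
  qed
  moreover have "u \<in> dom f'" if "c' \<in> set (c # cs)" "u \<in> D" "d c' u \<le> enat n" for c' u
    using that f1(4) f'(2,4) map_le_implies_dom_le by fastforce
  moreover have "lab_inv D (L @ c # cs) f'" using f'(1) by simp
  ultimately show ?case using map_le_trans[OF f1(2) f'(2)] by blast
qed

end

subsection \<open>Labelling along a tree-decomposition\<close>

locale rooted_decomposition = rooted_tree T r par dep
  for T :: "'t ugraph" and r :: 't and par :: "'t \<Rightarrow> 't" and dep :: "'t \<Rightarrow> nat" +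
  fixes G :: "'a ugraph" and J :: "'t \<Rightarrow> 'a set" and k n :: nat
  assumes simple_G: "simple_graph G"
    and acyclic: "\<nexists>xs. graph_cycle T xs"
    and decomp: "tree_indexed_decomposition T G J"
    and bag_size: "t \<in> verts T \<Longrightarrow> finite (J t) \<and> card (J t) \<le> k + 1"
begin

sublocale ball_labelling "gdist G" n k
  by unfold_locales (rule gdist_sym, rule gdist_triangle)

section \<open>Apexes, adhesion sets and separation\<close>

definition apex :: "'a \<Rightarrow> 't" where
  "apex v = (SOME b. b \<in> verts T \<and> v \<in> J b \<and>
     (\<forall>t \<in> verts T. v \<in> J t \<longrightarrow> t \<in> sub b \<and> (t \<noteq> b \<longrightarrow> v \<in> J (par t))))"

text \<open>The part of \<open>G\<close> behind the adhesion set of \<open>t\<close>: these vertices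
  occur only in bags at descendants of \<open>t\<close>.\<close>

definition D :: "'t \<Rightarrow> 'a set" where
  "D t = {v \<in> verts G. apex v \<in> sub t}"

definition newv :: "'t \<Rightarrow> 'a set" where
  "newv t = {v \<in> J t. apex v = t}"

text \<open>For \<open>t\<close> other than the root this is the adhesion set
  \<open>J t \<inter> J (par t)\<close>; at the root it is empty.\<close>

definition A :: "'t \<Rightarrow> 'a set" where
  "A t = {v \<in> J t. apex v \<noteq> t}"

lemma bag_verts: "t \<in> verts T \<Longrightarrow> v \<in> J t \<Longrightarrow> v \<in> verts G"
  using decomp by (auto simp: tree_indexed_decomposition_def)

text \<open>The nodes whose bags contain \<open>v\<close> form a subtree, and
  \<open>connected_top\<close> supplies its highest node.\<close>

lemma apex:
  assumes "v \<in> verts G"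
  shows "apex v \<in> verts T" "v \<in> J (apex v)"
    and "t \<in> verts T \<Longrightarrow> v \<in> J t \<Longrightarrow> t \<in> sub (apex v)"
    and "t \<in> verts T \<Longrightarrow> v \<in> J t \<Longrightarrow> t \<noteq> apex v \<Longrightarrow> v \<in> J (par t)"
proof -
  have "connected_graph (induced T {t \<in> verts T. v \<in> J t})"
    using decomp assms by (auto simp: tree_indexed_decomposition_def tree_def)
  then have "\<exists>b. b \<in> verts T \<and> v \<in> J b \<and>
      (\<forall>t \<in> verts T. v \<in> J t \<longrightarrow> t \<in> sub b \<and> (t \<noteq> b \<longrightarrow> v \<in> J (par t)))"
    using connected_top by fastforce
  from someI_ex[OF this, folded apex_def]
  show "apex v \<in> verts T" "v \<in> J (apex v)" "t \<in> verts T \<Longrightarrow> v \<in> J t \<Longrightarrow> t \<in> sub (apex v)"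
    "t \<in> verts T \<Longrightarrow> v \<in> J t \<Longrightarrow> t \<noteq> apex v \<Longrightarrow> v \<in> J (par t)" by blast+
qed

lemma newv_D: "t \<in> verts T \<Longrightarrow> newv t \<subseteq> D t"
  using bag_verts sub_refl by (auto simp: newv_def D_def)

lemma A_par:
  assumes "t \<in> verts T" "j \<in> A t"
  shows "t \<noteq> r" "j \<in> J (par t)"
proof -
  have j: "j \<in> J t" "apex j \<noteq> t" "j \<in> verts G" using assms bag_verts by (auto simp: A_def)
  then show "t \<noteq> r" using apex(3)[OF j(3) assms(1) j(1)] root_in_sub by auto
  show "j \<in> J (par t)" using apex(4)[OF j(3) assms(1) j(1)] j(2) by auto
qed

lemma D_par: "t \<in> verts T \<Longrightarrow> D t \<subseteq> D (par t)"
  using sub_par_mono by (auto simp: D_def)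

text \<open>Climbing from \<open>s\<close> to \<open>t\<close> cannot pass the apex of
  \<open>z\<close> before \<open>t\<close>, so \<open>z\<close> stays in every bag on the
  way.\<close>

lemma bag_up:
  assumes "s \<in> sub t" and "z \<in> J s" and "z \<in> verts G" and "apex z \<notin> sub t"
  shows "z \<in> J t"
  using assms
proof (induction "dep s" arbitrary: s rule: less_induct)
  case less
  show ?case
  proof (cases "s = t")
    case True
    then show ?thesis using less by simp
  next
    case False
    have s: "s \<in> verts T" "par s \<in> sub t" using less.prems(1) False sub_verts sub_par by auto
    have "s \<noteq> apex z" using less.prems by auto
    then have "z \<in> J (par s)" using apex(4)[OF less.prems(3) s(1) less.prems(2)] by auto
    moreover have "s \<noteq> r" using less.prems(1) False root_in_sub by auto
    then have "dep (par s) < dep s" using par(3)[OF s(1)] by simp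
    ultimately show ?thesis using less.hyps s(2) less.prems(3,4) by blast
  qed
qed

text \<open>\<open>A t\<close> separates \<open>D t\<close> from the rest: an edge leaving
  \<open>D t\<close> lies in a bag at a descendant of \<open>t\<close>, and by \<open>bag_up\<close>
  its outer end then lies in \<open>J t\<close> without having its apex there.\<close>

lemma crossing:
  assumes "t \<in> verts T" and u: "u \<in> D t" and x: "x \<notin> D t" and "gdist G x u \<noteq> \<infinity>"
  shows "\<exists>j \<in> A t. gdist G x j + gdist G j u = gdist G x u"
proof (rule gdist_through[OF assms(4)])
  fix xs assume "walk_between G x xs u"
  from walk_leaves[OF walk_between_rev[OF this] u x]
  obtain y z where yz: "z \<in> set xs" "adjacent G y z" "y \<in> D t" "z \<notin> D t" by auto
  from yz(2) obtain s where s: "s \<in> verts T" "y \<in> J s" "z \<in> J s"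
    using decomp unfolding tree_indexed_decomposition_def by blast
  have z: "z \<in> verts G" using bag_verts s by blast
  have y: "y \<in> verts G" "apex y \<in> sub t" using yz by (auto simp: D_def)
  have "s \<in> sub t" using apex(3)[OF y(1) s(1,2)] y(2) sub_trans by blast
  moreover have nz: "apex z \<notin> sub t" using yz(4) z by (auto simp: D_def)
  ultimately have "z \<in> J t" using bag_up s(3) z by blast
  moreover have "apex z \<noteq> t" using nz sub_refl[OF assms(1)] by auto
  ultimately show "set xs \<inter> A t \<noteq> {}" using yz(1) by (auto simp: A_def)
qed

section \<open>One step of the walk down the tree\<close>

text \<open>By the last clause, a vertex of \<open>D e\<close>, for a child \<open>e\<close> of
  \<open>t\<close>, that is within distance \<open>n\<close> of a vertex outside \<open>D e\<close>
  is labelled before \<open>e\<close> is entered.\<close>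

definition state_inv :: "'t \<Rightarrow> 'a list \<Rightarrow> ('a \<rightharpoonup> 'a) \<Rightarrow> bool" where
  "state_inv t L f \<longleftrightarrow> lab_inv (D t) L f \<and> set L \<subseteq> verts G \<and>
     (\<forall>c \<in> set L. t \<in> sub (apex c)) \<and> length L \<le> card (J t) \<and> newv t \<subseteq> set L \<and>
     (\<forall>j \<in> J t. \<forall>u \<in> D t. gdist G j u \<le> enat n \<longrightarrow> u \<in> dom f)"

text \<open>\<open>p\<close> is the state on entering \<open>t\<close>, \<open>q\<close> the state
  on leaving it. The last clause prepares adjacency in the index graph: a label given at
  \<open>t\<close> shares the incoming or the outgoing list with the label of every labelled vertex
  close by.\<close>

definition ext :: "'t \<Rightarrow> 'a list \<times> ('a \<rightharpoonup> 'a) \<Rightarrow> 'a list \<times> ('a \<rightharpoonup> 'a) \<Rightarrow> bool" where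
  "ext t p q \<longleftrightarrow> state_inv t (fst q) (snd q) \<and> snd p \<subseteq>\<^sub>m snd q \<and>
     set (fst q) \<subseteq> set (fst p) \<union> newv t \<and>
     (\<forall>u v x y. snd q u = Some x \<longrightarrow> snd q v = Some y \<longrightarrow> v \<notin> dom (snd p) \<longrightarrow>
        gdist G u v \<le> enat n \<longrightarrow> {x, y} \<subseteq> set (fst p) \<or> {x, y} \<subseteq> set (fst q))"

text \<open>At most \<open>card (A t)\<close> labels survive the reduction, so appending
  \<open>newv t\<close> keeps the length within \<open>card (J t)\<close>, hence within
  \<open>k + 1\<close>.\<close>

lemma ext_exists:
  assumes t: "t \<in> verts T" and inv: "lab_inv (D t) L f" and LG: "set L \<subseteq> verts G"
    and LD: "set L \<inter> D t = {}" and Lt: "\<And>c. c \<in> set L \<Longrightarrow> t \<in> sub (apex c)"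
    and N: "\<And>j u. j \<in> A t \<Longrightarrow> u \<in> D t \<Longrightarrow> gdist G j u \<le> enat n \<Longrightarrow> u \<in> dom f"
  shows "\<exists>q. ext t (L, f) q"
proof -
  have J: "J t = A t \<union> newv t" "A t \<inter> newv t = {}" by (auto simp: A_def newv_def)
  have fin: "finite (A t)" "finite (newv t)" using bag_size[OF t] J(1) by auto
  then have card: "card (J t) = card (A t) + card (newv t)" using J card_Un_disjoint by metis
  have sep: "\<exists>j \<in> A t. gdist G x j + gdist G j u = gdist G x u"
    if "u \<in> D t" "x \<in> set L" "gdist G x u \<noteq> \<infinity>" for u x
    using crossing[OF t that(1) _ that(3)] that(2) LD by blast
  obtain L1 f1 where 1: "lab_inv (D t) L1 f1" "length L1 \<le> card (A t)" "set L1 \<subseteq> set L" "f \<subseteq>\<^sub>m f1"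
      "\<And>v x. v \<notin> dom f \<Longrightarrow> f1 v = Some x \<Longrightarrow> v \<in> D t \<and> x \<in> set L"
    using reduce_labels[OF inv LD fin(1) sep] by blast
  obtain cs where cs: "set cs = newv t" "distinct cs" using finite_distinct_list[OF fin(2)] by blast
  have "length cs = card (newv t)" using distinct_card[OF cs(2)] cs(1) by simp
  then have len: "length (L1 @ cs) \<le> card (J t)" using 1(2) card by simp
  have "length L1 + length cs \<le> k + 1" using len bag_size[OF t] by simp
  moreover have "set cs \<subseteq> D t" "set cs \<inter> set L1 = {}" using newv_D[OF t] 1(3) LD cs by auto
  ultimately obtain f2 where 2: "lab_inv (D t) (L1 @ cs) f2" "f1 \<subseteq>\<^sub>m f2"
      "\<And>v x. v \<notin> dom f1 \<Longrightarrow> f2 v = Some x \<Longrightarrow> v \<in> D t \<and> x \<in> set cs"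
      "\<And>c u. c \<in> set cs \<Longrightarrow> u \<in> D t \<Longrightarrow> gdist G c u \<le> enat n \<Longrightarrow> u \<in> dom f2"
    using append_labels[OF 1(1), of cs] cs(2) by blast
  have f2: "f \<subseteq>\<^sub>m f2" using 1(4) 2(2) map_le_trans by blast
  have f2f1: "f2 v = f1 v" if "v \<in> dom f1" for v using 2(2) that by (auto simp: map_le_def)
  have f1f: "f1 v = f v" if "v \<in> dom f" for v using 1(4) that by (auto simp: map_le_def)
  have dm: "dom f \<subseteq> dom f1" "dom f1 \<subseteq> dom f2" using 1(4) 2(2) map_le_implies_dom_le by blast+
  have "state_inv t (L1 @ cs) f2"
    unfolding state_inv_def
  proof (intro conjI ballI impI)
    show "lab_inv (D t) (L1 @ cs) f2" by (fact 2)
    show "set (L1 @ cs) \<subseteq> verts G" using 1(3) LG cs newv_D[OF t] by (auto simp: D_def)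
    show "t \<in> sub (apex c)" if "c \<in> set (L1 @ cs)" for c
      using that 1(3) Lt cs sub_refl[OF t] by (auto simp: newv_def)
    show "length (L1 @ cs) \<le> card (J t)" by (fact len)
    show "newv t \<subseteq> set (L1 @ cs)" using cs by simp
    show "u \<in> dom f2" if "j \<in> J t" "u \<in> D t" "gdist G j u \<le> enat n" for j u
      using that 2(4) N dm J cs(1) by blast
  qed
  moreover have "{x, y} \<subseteq> set L \<or> {x, y} \<subseteq> set (L1 @ cs)"
    if u: "f2 u = Some x" and v: "f2 v = Some y" "v \<notin> dom f" and uv: "gdist G u v \<le> enat n" for u v x y
  proof -
    have new: "w \<in> D t" if "w \<notin> dom f" "f2 w = Some z" for w z
      using that 1(5)[of w] 2(3)[of w] f2f1[of w] by (cases "w \<in> dom f1") auto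
    have vD: "v \<in> D t" using new v by blast
    \<comment> \<open>A geodesic coming from outside \<open>D t\<close> passes some \<open>j\<close>
      in \<open>A t\<close> that is close to \<open>v\<close>; by \<open>N\<close> the vertex
      \<open>v\<close> would have been labelled already.\<close>
    have uD: "u \<in> D t"
    proof (rule ccontr)
      assume "u \<notin> D t"
      moreover have "gdist G u v \<noteq> \<infinity>" using uv by (cases "gdist G u v") auto
      ultimately obtain j where j: "j \<in> A t" "gdist G u j + gdist G j v = gdist G u v"
        using crossing[OF t vD] by blast
      then have "gdist G j v \<le> enat n" using uv by (metis add_increasing zero_le order_refl order_trans)
      then show False using N[OF j(1) vD] v(2) by blast
    qed
    have vu: "gdist G v u \<le> enat n" using uv gdist_sym by metis
    \<comment> \<open>Whichever of the two vertices is labelled first pokes as long as the other is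
      unlabelled, so its label is still active when the other one is labelled. If both are labelled
      in the same phase, both labels come from \<open>L\<close> or both from
      \<open>cs\<close>.\<close>
    show ?thesis
    proof (cases "v \<in> dom f1")
      case False
      then have y: "y \<in> set cs" using 2(3) v by blast
      show ?thesis
      proof (cases "u \<in> dom f1")
        case True
        then have "poke (D t) f1 x u" unfolding poke_def using uD vD vu False f2f1[OF True] u by auto
        from lab_invD(6)[OF 1(1) this] y show ?thesis by simp
      next
        case False
        then show ?thesis using 2(3) u y by auto
      qed
    next
      case True
      then have y: "f1 v = Some y" "y \<in> set L" using f2f1 v 1(5) by auto
      consider "u \<in> dom f" | "u \<notin> dom f" "u \<in> dom f1" | "u \<notin> dom f1" by blast
      then show ?thesis
      proof cases
        case 1
        then have "f u = Some x" using u f1f f2f1 dm by (metis subsetD)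
        then have "poke (D t) f x u" unfolding poke_def using uD vD vu v(2) by blast
        from lab_invD(6)[OF inv this] y show ?thesis by simp
      next
        case 2
        then show ?thesis using 1(5)[OF 2(1)] u y f2f1 by auto
      next
        case 3
        have "poke (D t) f1 y v" unfolding poke_def using uD vD uv y 3 by blast
        from lab_invD(6)[OF 1(1) this] 2(3)[OF 3 u] show ?thesis by simp
      qed
    qed
  qed
  moreover have "set (L1 @ cs) \<subseteq> set L \<union> newv t" using 1(3) cs by auto
  ultimately have "ext t (L, f) (L1 @ cs, f2)"
    unfolding ext_def fst_conv snd_conv using f2 by (intro conjI allI impI)
  then show ?thesis ..
qed

text \<open>The recursion runs over the depth, since the tree is not a datatype; only
  \<open>stage (dep t) t\<close> is meaningful, and the base case serves the root.\<close>

primrec stage :: "nat \<Rightarrow> 't \<Rightarrow> 'a list \<times> ('a \<rightharpoonup> 'a)" where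
  "stage 0 t = (SOME q. ext t ([], Map.empty) q)"
| "stage (Suc m) t = (SOME q. ext t (stage m (par t)) q)"

definition Lab :: "'t \<Rightarrow> 'a set" where "Lab t = set (fst (stage (dep t) t))"
definition asg :: "'t \<Rightarrow> 'a \<rightharpoonup> 'a" where "asg t = snd (stage (dep t) t)"

definition prev :: "'t \<Rightarrow> 'a list \<times> ('a \<rightharpoonup> 'a)" where
  "prev t = (if t = r then ([], Map.empty) else stage (dep (par t)) (par t))"

lemma ext_stage: "t \<in> verts T \<Longrightarrow> ext t (prev t) (stage (dep t) t)"
proof (induction "dep t" arbitrary: t rule: less_induct)
  case less
  note t = less.prems
  show ?case
  proof (cases "t = r")
    case True
    \<comment> \<open>\<open>A r\<close> is empty by \<open>A_par\<close>, so the hypothesis on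
      vertices close to it is vacuous.\<close>
    have "\<exists>q. ext r ([], Map.empty) q"
      using A_par(1)[OF root(1)] by (intro ext_exists) (auto simp: root lab_inv_empty)
    from someI_ex[OF this] show ?thesis by (simp add: True prev_def root)
  next
    case False
    let ?s = "par t"
    note p = par[OF t False]
    obtain L f where Lf: "stage (dep ?s) ?s = (L, f)" by (cases "stage (dep ?s) ?s")
    have "ext ?s (prev ?s) (L, f)" using less.hyps[of ?s] p Lf by simp
    then have I: "state_inv ?s L f" by (simp add: ext_def)
    have "\<exists>q. ext t (L, f) q"
    proof (rule ext_exists[OF t])
      show "lab_inv (D t) L f" using I lab_inv_mono D_par[OF t] by (auto simp: state_inv_def)
      show "set L \<subseteq> verts G" using I by (simp add: state_inv_def)
      have s: "?s \<in> sub (apex c)" if "c \<in> set L" for c using I that by (simp add: state_inv_def)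
      \<comment> \<open>A label in \<open>D t\<close> would have its apex below \<open>t\<close>,
        while the apex of an active label is at or above \<open>par t\<close>.\<close>
      show "set L \<inter> D t = {}"
        using s sub_trans parent_not_in_sub[OF t False] by (auto simp: D_def)
      show "t \<in> sub (apex c)" if "c \<in> set L" for c using sub_step s that t by blast
      show "u \<in> dom f" if "j \<in> A t" "u \<in> D t" "gdist G j u \<le> enat n" for j u
        using I that A_par(2)[OF t] D_par[OF t] unfolding state_inv_def by blast
    qed
    from someI_ex[OF this] show ?thesis by (simp add: False prev_def p Lf)
  qed
qed

lemma stage_inv:
  assumes "t \<in> verts T"
  shows "Lab t \<subseteq> verts G" "c \<in> Lab t \<Longrightarrow> t \<in> sub (apex c)" "card (Lab t) \<le> k + 1" "finite (Lab t)"
    "newv t \<subseteq> Lab t" "asg t v = Some x \<Longrightarrow> gdist G x v \<le> enat ((k + 1) * n)"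
    "j \<in> J t \<Longrightarrow> u \<in> D t \<Longrightarrow> gdist G j u \<le> enat n \<Longrightarrow> u \<in> dom (asg t)"
proof -
  have I: "state_inv t (fst (stage (dep t) t)) (asg t)"
    using ext_stage[OF assms] by (simp add: ext_def asg_def)
  then show "Lab t \<subseteq> verts G" "c \<in> Lab t \<Longrightarrow> t \<in> sub (apex c)" "newv t \<subseteq> Lab t"
    "j \<in> J t \<Longrightarrow> u \<in> D t \<Longrightarrow> gdist G j u \<le> enat n \<Longrightarrow> u \<in> dom (asg t)"
    by (auto simp: state_inv_def Lab_def)
  show "asg t v = Some x \<Longrightarrow> gdist G x v \<le> enat ((k + 1) * n)"
    using I lab_invD(7) unfolding state_inv_def K_def by blast
  have "length (fst (stage (dep t) t)) \<le> k + 1"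
    using I lab_invD(2) unfolding state_inv_def by blast
  then show "card (Lab t) \<le> k + 1"
    unfolding Lab_def using card_length le_trans by blast
  show "finite (Lab t)" by (simp add: Lab_def)
qed

text \<open>A label enters a list only at its apex, as a new vertex; everywhere else it is inherited
  from the parent.\<close>

lemma Lab_step:
  assumes "t \<in> verts T" and "c \<in> Lab t" and "t \<noteq> apex c"
  shows "c \<in> Lab (par t)"
  using ext_stage[OF assms(1)] assms
  by (auto simp: ext_def Lab_def prev_def newv_def split: if_splits)

lemma asg_step: "t \<in> verts T \<Longrightarrow> t \<noteq> r \<Longrightarrow> asg (par t) \<subseteq>\<^sub>m asg t"
  using ext_stage[of t] by (auto simp: ext_def asg_def prev_def)

lemma asg_sub: "t \<in> sub s \<Longrightarrow> asg s \<subseteq>\<^sub>m asg t"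
proof (induction "dep t" arbitrary: t rule: less_induct)
  case less
  show ?case
  proof (cases "t = s")
    case False
    then have t: "t \<in> verts T" "t \<noteq> r" "par t \<in> sub s"
      using less.prems sub_verts sub_par sub_not_root by blast+
    then show ?thesis using less.hyps[of "par t"] par(3) asg_step map_le_trans by fastforce
  qed simp
qed

text \<open>Climb while both vertices are already labelled on entering the node. Where this first
  fails, one of them is labelled at that node, and the closeness clause of \<open>ext\<close>
  applies.\<close>

lemma cooccur:
  assumes "t \<in> verts T" and "asg t u = Some x" and "asg t v = Some y" and "gdist G u v \<le> enat n"
  shows "\<exists>s \<in> verts T. x \<in> Lab s \<and> y \<in> Lab s"
  using assms
proof (induction "dep t" arbitrary: t rule: less_induct)
  case less
  note t = less.prems(1)
  let ?p = "fst (prev t)" and ?f = "snd (prev t)"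
  have le: "?f \<subseteq>\<^sub>m asg t"
    and close: "\<And>u v x y. asg t u = Some x \<Longrightarrow> asg t v = Some y \<Longrightarrow> v \<notin> dom ?f \<Longrightarrow>
      gdist G u v \<le> enat n \<Longrightarrow> {x, y} \<subseteq> set ?p \<or> {x, y} \<subseteq> Lab t"
    using ext_stage[OF t] unfolding ext_def asg_def Lab_def by blast+
  have prevL: "\<exists>s \<in> verts T. x \<in> Lab s \<and> y \<in> Lab s" if "{x, y} \<subseteq> set ?p"
    using that par_in_verts[OF t] by (auto simp: prev_def Lab_def split: if_splits)
  have vu: "gdist G v u \<le> enat n" using less.prems(4) gdist_sym by metis
  show ?case
  proof (cases "u \<in> dom ?f \<and> v \<in> dom ?f")
    case True
    then have "t \<noteq> r" by (auto simp: prev_def)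
    then have f: "?f = asg (par t)" by (simp add: prev_def asg_def)
    have "?f u = asg t u" "?f v = asg t v" using True le unfolding map_le_def by blast+
    then have "asg (par t) u = Some x" "asg (par t) v = Some y" using less.prems f by simp_all
    then show ?thesis using less.hyps[of "par t"] par[OF t \<open>t \<noteq> r\<close>] less.prems(4) by simp
  next
    case False
    then have "{x, y} \<subseteq> set ?p \<or> {x, y} \<subseteq> Lab t"
    proof (cases "v \<in> dom ?f")
      case True
      with False have "u \<notin> dom ?f" by blast
      from close[OF less.prems(3,2) this vu] show ?thesis by (simp only: insert_commute)
    next
      case False
      from close[OF less.prems(2,3) this less.prems(4)] show ?thesis .
    qed
    then show ?thesis using prevL t by blast
  qed
qed

section \<open>The final labels\<close>

definition lab :: "'a \<Rightarrow> 'a" where "lab v = the (asg (apex v) v)"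

text \<open>A vertex is labelled at its apex at the latest, being at distance 0 from the bag that
  contains it.\<close>

lemma asg_apex:
  assumes "v \<in> verts G"
  shows "asg (apex v) v = Some (lab v)"
proof -
  have "v \<in> D (apex v)" using assms apex(1) sub_refl by (auto simp: D_def)
  then have "v \<in> dom (asg (apex v))"
    using stage_inv(7)[OF apex(1)[OF assms] apex(2)[OF assms]] gdist_refl[OF assms] by simp
  then show ?thesis by (auto simp: lab_def)
qed

lemma asg_lab:
  assumes "v \<in> D s" and "v \<in> dom (asg s)"
  shows "asg s v = Some (lab v)"
proof -
  have v: "v \<in> verts G" "apex v \<in> sub s" using assms(1) by (auto simp: D_def)
  have "asg s v = asg (apex v) v"
    using asg_sub[OF v(2)] assms(2) unfolding map_le_def by blast
  then show ?thesis using asg_apex[OF v(1)] by simp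
qed

text \<open>It suffices to find a node where both are labelled. With comparable apexes it is the
  lower one. Otherwise it is the lowest common ancestor \<open>s\<close>: a geodesic from
  \<open>v\<close> to \<open>u\<close> enters the branch of \<open>u\<close> through a vertex of
  \<open>J s\<close>, to which both are close.\<close>

lemma lab_close:
  assumes u: "u \<in> verts G" and v: "v \<in> verts G" and uv: "gdist G u v \<le> enat n"
  shows "\<exists>s \<in> verts T. lab u \<in> Lab s \<and> lab v \<in> Lab s"
proof -
  have vu: "gdist G v u \<le> enat n" using uv gdist_sym by metis
  have comp: "asg (apex w) z = Some (lab z)" if "apex w \<in> sub (apex z)" "z \<in> verts G" for w z
  proof -
    have "asg (apex z) z = asg (apex w) z"
      using asg_sub[OF that(1)] asg_apex[OF that(2)] unfolding map_le_def by blast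
    then show ?thesis using asg_apex[OF that(2)] by simp
  qed
  consider "apex u \<in> sub (apex v)" | "apex v \<in> sub (apex u)"
    | "apex u \<notin> sub (apex v)" "apex v \<notin> sub (apex u)" by blast
  then show ?thesis
  proof cases
    case 1
    from cooccur[OF apex(1)[OF u] asg_apex[OF u] comp[OF 1 v] uv] show ?thesis .
  next
    case 2
    from cooccur[OF apex(1)[OF v] comp[OF 2 u] asg_apex[OF v] uv] show ?thesis .
  next
    case 3
    let ?P = "\<lambda>s. apex u \<in> sub s \<and> apex v \<in> sub s"
    have "?P r" using sub_root apex(1) u v by blast
    \<comment> \<open>\<open>ex_has_greatest_nat\<close> asks for a strict bound, hence the
      \<open>Suc\<close>.\<close>
    moreover have "\<forall>s. ?P s \<longrightarrow> dep s < Suc (dep (apex u))" using sub_dep by (simp add: less_Suc_eq_le)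
    ultimately have "\<exists>s. ?P s \<and> (\<forall>e. ?P e \<longrightarrow> dep e \<le> dep s)"
      by (rule ex_has_greatest_nat)
    then obtain s where s: "apex u \<in> sub s" "apex v \<in> sub s"
      and max: "\<And>e. apex u \<in> sub e \<Longrightarrow> apex v \<in> sub e \<Longrightarrow> dep e \<le> dep s" by blast
    have "apex u \<noteq> s" using 3 s by blast
    then obtain e where e: "e \<in> verts T" "e \<noteq> r" "par e = s" "apex u \<in> sub e"
      using sub_child[OF s(1)] by blast
    have "apex v \<notin> sub e" using max[OF e(4)] e(3) par(3)[OF e(1,2)] by auto
    then have "u \<in> D e" "v \<notin> D e" using e u by (auto simp: D_def)
    moreover have "gdist G v u \<noteq> \<infinity>" using vu by (cases "gdist G v u") auto
    ultimately obtain j where j: "j \<in> A e" "gdist G v j + gdist G j u = gdist G v u"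
      using crossing[OF e(1)] by blast
    have js: "j \<in> J s" using A_par(2)[OF e(1) j(1)] e(3) by simp
    have D: "u \<in> D s" "v \<in> D s" using s u v by (simp_all add: D_def)
    have "gdist G j u \<le> gdist G v u" "gdist G v j \<le> gdist G v u"
      unfolding j(2)[symmetric] by simp_all
    then have ju: "gdist G j u \<le> enat n" and jv: "gdist G j v \<le> enat n"
      using vu gdist_sym[of G v j] by (simp_all only: order_trans)
    have sT: "s \<in> verts T" using e par_in_verts by blast
    have "u \<in> dom (asg s)" "v \<in> dom (asg s)" using stage_inv(7)[OF sT js] D ju jv by blast+
    with cooccur[OF sT asg_lab[OF D(1)] asg_lab[OF D(2)] uv] show ?thesis by blast
  qed
qed

section \<open>The index graph, its decomposition and the partition\<close>

text \<open>Labels are encoded as singletons to fit the type \<open>'a set ugraph\<close>. Every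
  vertex of \<open>G\<close> is an active label at its apex and so gives a vertex of
  \<open>H\<close>, possibly with an empty part.\<close>

definition H :: "'a set ugraph" where
  "H = \<lparr>verts = (\<lambda>c. {c}) ` verts G,
        edges = {{{x}, {y}} | x y. x \<noteq> y \<and> (\<exists>t \<in> verts T. x \<in> Lab t \<and> y \<in> Lab t)}\<rparr>"

definition B :: "'t \<Rightarrow> 'a set set" where
  "B t = (\<lambda>c. {c}) ` Lab t"

definition P :: "'a set \<Rightarrow> 'a set" where
  "P X = {v \<in> verts G. {lab v} = X}"

lemma adjacent_H: "adjacent H {x} {y} \<longleftrightarrow> x \<noteq> y \<and> (\<exists>t \<in> verts T. x \<in> Lab t \<and> y \<in> Lab t)"
  by (auto simp: adjacent_def H_def doubleton_eq_iff)

lemma simple_H: "simple_graph H"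
  unfolding simple_graph_def
proof
  fix e assume "e \<in> edges H"
  then obtain x y t where "e = {{x}, {y}}" "x \<noteq> y" "t \<in> verts T" "x \<in> Lab t" "y \<in> Lab t"
    by (auto simp: H_def)
  moreover from this have "x \<in> verts G" "y \<in> verts G" using stage_inv(1) by blast+
  ultimately show "\<exists>u \<in> verts H. \<exists>v \<in> verts H. u \<noteq> v \<and> e = {u, v}"
    by (intro bexI[of _ "{x}"] bexI[of _ "{y}"]) (auto simp: H_def)
qed

text \<open>The nodes where \<open>c\<close> is active contain \<open>apex c\<close>, lie below it
  and, by \<open>Lab_step\<close>, are closed under parents up to it; so they form a
  subtree.\<close>

lemma decomposition_H: "tree_indexed_decomposition T H B"
  unfolding tree_indexed_decomposition_def
proof (intro conjI ballI allI impI)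
  show "B t \<subseteq> verts H" if "t \<in> verts T" for t
    using stage_inv(1)[OF that] by (auto simp: B_def H_def)
  show "tree (induced T {t \<in> verts T. X \<in> B t})" if X: "X \<in> verts H" for X
  proof -
    obtain c where c: "c \<in> verts G" "X = {c}" using X by (auto simp: H_def)
    have S: "{t \<in> verts T. X \<in> B t} = {t \<in> verts T. c \<in> Lab t}" using c by (auto simp: B_def)
    have "apex c \<in> verts T" "c \<in> newv (apex c)" using apex(1,2) c(1) by (auto simp: newv_def)
    then have "c \<in> Lab (apex c)" using stage_inv(5) by blast
    show ?thesis
      unfolding S
    proof (rule subtree[OF _ _ _ acyclic])
      show "apex c \<in> verts T \<inter> {t \<in> verts T. c \<in> Lab t}"
        using \<open>apex c \<in> verts T\<close> \<open>c \<in> Lab (apex c)\<close> by simp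
      fix t assume t: "t \<in> verts T \<inter> {t \<in> verts T. c \<in> Lab t}"
      then show "t \<in> sub (apex c)" using stage_inv(2) by blast
      show "par t \<in> {t \<in> verts T. c \<in> Lab t}" if "t \<noteq> apex c"
        using t that Lab_step par_in_verts by blast
    qed
  qed
  fix X Y assume XY: "adjacent H X Y"
  from adjacent_verts[OF simple_H XY] obtain x y where "X = {x}" "Y = {y}" by (auto simp: H_def)
  with XY show "\<exists>t \<in> verts T. X \<in> B t \<and> Y \<in> B t" by (auto simp: adjacent_H B_def)
qed

lemma width_H: "width T B \<le> ereal (real k)"
  unfolding width_le_iff B_def using stage_inv(3,4) card_image_le le_trans by blast

lemma lab_verts: "v \<in> verts G \<Longrightarrow> lab v \<in> verts G"
  using lab_close[of v v] gdist_refl[of v G] stage_inv(1) by (metis subsetD zero_le)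

lemma partition_P: "graph_indexed_partition H G P"
  using lab_verts by (auto simp: graph_indexed_partition_def H_def P_def)

lemma adjacent_close:
  assumes "X \<in> verts H" and "Y \<in> verts H" and "X \<noteq> Y" and "set_gdist G (P X) (P Y) \<le> enat n"
  shows "adjacent H X Y"
proof -
  \<comment> \<open>The strict form yields witnesses through \<open>INF_less_iff\<close>; for an
    empty part the distance would be infinite.\<close>
  have "set_gdist G (P X) (P Y) < enat (Suc n)"
    using assms(4) by (rule order_le_less_trans) simp
  then obtain u v where uv: "u \<in> P X" "v \<in> P Y" "gdist G u v < enat (Suc n)"
    unfolding set_gdist_def by (auto simp: INF_less_iff)
  then have "gdist G u v \<le> enat n" by (cases "gdist G u v") auto
  with lab_close[of u v] uv show ?thesis
    using assms(3) by (auto simp: P_def adjacent_H)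
qed

text \<open>Two vertices of a part are joined through their common label, which may itself lie
  outside the part.\<close>

lemma weak_diameter_P: "weak_diameter G (P X) \<le> enat (2 * ((k + 1) * n))"
proof -
  have r: "gdist G (lab v) v \<le> enat ((k + 1) * n)" if "v \<in> verts G" for v
    using stage_inv(6)[OF apex(1)[OF that] asg_apex[OF that]] .
  have "gdist G u v \<le> enat (2 * ((k + 1) * n))" if "u \<in> P X" "v \<in> P X" for u v
  proof -
    have uv: "u \<in> verts G" "v \<in> verts G" "lab u = lab v" using that by (auto simp: P_def)
    have "gdist G u v \<le> gdist G u (lab u) + gdist G (lab u) v" by (rule gdist_triangle)
    also have "\<dots> \<le> enat ((k + 1) * n) + enat ((k + 1) * n)"
      using r[OF uv(1)] r[OF uv(2)] uv(3) gdist_sym[of G u] by (intro add_mono) simp_all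
    finally show ?thesis by (simp only: plus_enat_simps mult_2)
  qed
  then show ?thesis unfolding weak_diameter_def by (intro SUP_least) 
qed

end

theorem theorem9:
  fixes k :: nat and l :: real
    and G :: "'a ugraph" and T :: "'t ugraph" and J :: "'t \<Rightarrow> 'a set"
  assumes "l \<ge> 0"
    and "simple_graph G"
    and "tree T"
    and "tree_indexed_decomposition T G J"
    and "width T J \<le> ereal (real k)"
  shows "\<exists>(H :: 'a set ugraph) (B :: 't \<Rightarrow> 'a set set) (P :: 'a set \<Rightarrow> 'a set).
           simple_graph H \<and> (finite (verts G) \<longrightarrow> finite (verts H)) \<and>
           tree_indexed_decomposition T H B \<and> width T B \<le> ereal (real k) \<and>
           graph_indexed_partition H G P \<and> compressing l H G P \<and>
           (\<forall>x \<in> verts H.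
              ereal_of_enat (weak_diameter G (P x)) \<le> ereal (2 * (real k + 1) * l))"
proof -
  obtain r par dep where "rooted_tree T r par dep" using tree_rooted[OF assms(3)] .
  \<comment> \<open>Distances are natural numbers or infinite, so comparing them with
    \<open>l\<close> is the same as comparing them with its integer part.\<close>
  then interpret rooted_decomposition T r par dep G J k "nat \<lfloor>l\<rfloor>"
    using assms by (auto simp: rooted_decomposition_def rooted_decomposition_axioms_def
        width_le_iff tree_def)
  have n: "real (nat \<lfloor>l\<rfloor>) \<le> l" using assms(1) by simp
  have "compressing l H G P"
    unfolding compressing_def
  proof (intro ballI impI, elim conjE)
    fix x y assume xy: "x \<in> verts H" "y \<in> verts H" "x \<noteq> y"
      and l: "ereal_of_enat (set_gdist G (P x) (P y)) \<le> ereal l"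
    from l have "set_gdist G (P x) (P y) \<le> enat (nat \<lfloor>l\<rfloor>)"
      by (cases "set_gdist G (P x) (P y)") (auto simp: le_nat_floor)
    with xy show "adjacent H x y" by (rule adjacent_close)
  qed
  moreover have "ereal_of_enat (weak_diameter G (P x)) \<le> ereal (2 * (real k + 1) * l)" for x
  proof -
    have "ereal_of_enat (weak_diameter G (P x)) \<le> ereal_of_enat (enat (2 * ((k + 1) * nat \<lfloor>l\<rfloor>)))"
      using weak_diameter_P by (simp only: ereal_of_enat_le_iff)
    also have "\<dots> = ereal (2 * (real k + 1) * real (nat \<lfloor>l\<rfloor>))" by (simp add: algebra_simps)
    also have "\<dots> \<le> ereal (2 * (real k + 1) * l)"
      using n by (simp only: ereal_less_eq) (intro mult_left_mono, auto)
    finally show ?thesis .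
  qed
  moreover have "finite (verts G) \<longrightarrow> finite (verts H)" by (simp add: H_def)
  ultimately show ?thesis
    using simple_H decomposition_H width_H partition_P by blast
qed

end
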